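(* Let $1<p\leq q<\infty$, $\nu>0$, $p>\nu$ and $0\leq\alpha<d$. Let $\mathcal{S}$ be a sparse collection of dyadic cubes in $\mathbb{R}^d$ and let $w,\sigma$ be a pair of weights. Then $$\|\mathcal{A}_{\alpha,\nu}^{\mathcal{S}}(\cdot\,\sigma)\|_{L^{p}(\sigma)\rightarrow L^{q,\infty}(w)}^{\nu}\simeq \mathscr{T}^{*},$$ where the testing constant is $$\mathscr{T}^{*}:=\sup_{R\in\mathcal{S}}w(R)^{-\frac{1}{(q/\nu)'}}\Big\|\sum_{\substack{Q\in\mathcal{S}\\ Q\subset R}}\langle\sigma\rangle_{\alpha,Q}^{\nu-1}\langle w\rangle_{\alpha,Q}\mathbf{1}_{Q}\Big\|_{L^{(p/\nu)'}(\sigma)}.$$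
   Context: A weight on $\mathbb{R}^d$ is a locally integrable function $w:\mathbb{R}^d\to(0,\infty)$; $w(E)=\int_E w$, and $L^p(\sigma)$, $L^{q,\infty}(w)$ are taken with respect to the measures $\sigma\,dx$, $w\,dx$. Dyadic cubes are those of a fixed dyadic grid on $\mathbb{R}^d$. A collection $\mathcal{S}$ of dyadic cubes is sparse (with parameter $0<\gamma<1$) if for each $Q\in\mathcal{S}$ there is $E_Q\subset Q$ with $|E_Q|\geq\gamma|Q|$, the sets $E_Q$, $Q\in\mathcal S$, being pairwise disjoint. For nonnegative $f$ set $$\langle f\rangle_{\alpha,Q}=\frac{1}{|Q|^{1-\alpha/d}}\int_Q f,\qquad \mathcal{A}_{\alpha,\nu}^{\mathcal{S}}(f)=\Big(\sum_{Q\in\mathcal{S}}\langle f\rangle_{\alpha,Q}^{\nu}\mathbf{1}_Q\Big)^{1/\nu}.$$ $\|\mathcal{A}_{\alpha,\nu}^{\mathcal{S}}(\cdot\,\sigma)\|_{L^p(\sigma)\to L^{q,\infty}(w)}$ is the least constant $C\in[0,\infty]$ with $\|\mathcal{A}_{\alpha,\nu}^{\mathcal{S}}(f\sigma)\|_{L^{q,\infty}(w)}\le C\|f\|_{L^p(\sigma)}$ for all nonnegative $f\in L^p(\sigma)$. For $1<r<\infty$, $r'$ denotes the conjugate exponent, $1/r+1/r'=1$. The notation $\simeq$ means two-sided inequality up to positive constants independent of $w$ and $\sigma$, depending only on $p,q,\nu,\alpha,d$ and the sparsity parameter $\gamma$. *)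

theory Defs
  imports "HOL-Analysis.Analysis"
begin

(* Real powers on [0,\<infinity>], with \<infinity>^a = \<infinity> for a > 0 and x^(-a) = 1 / x^a;
   note that powr alone would give 0 powr 0 = 0. *)
definition epowr :: "ennreal \<Rightarrow> real \<Rightarrow> ennreal" where
  "epowr x a =
     (let pow = (\<lambda>b. if x = \<infinity> then \<infinity> else ennreal (enn2real x powr b))
      in if a > 0 then pow a else if a = 0 then 1 else inverse (pow (- a)))"

definition conj_exp :: "real \<Rightarrow> real" where
  "conj_exp r = r / (r - 1)"

definition weight :: "(real^'n \<Rightarrow> real) \<Rightarrow> bool" where
  "weight w \<longleftrightarrow> (\<forall>x. 0 < w x) \<and> (\<forall>K. compact K \<longrightarrow> w absolutely_integrable_on K)"

definition weighted :: "(real^'n \<Rightarrow> real) \<Rightarrow> (real^'n) measure" where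
  "weighted w = density lebesgue (\<lambda>x. ennreal (w x))"

definition half_open_cube :: "real^'n \<Rightarrow> real \<Rightarrow> (real^'n) set" where
  "half_open_cube a l = {x. \<forall>i. a $ i \<le> x $ i \<and> x $ i < a $ i + l}"

definition dyadic_generation :: "(real^'n) set set \<Rightarrow> int \<Rightarrow> (real^'n) set set" where
  "dyadic_generation D k = {Q \<in> D. \<exists>a. Q = half_open_cube a (2 powi k)}"

definition dyadic_grid :: "(real^'n) set set \<Rightarrow> bool" where
  "dyadic_grid D \<longleftrightarrow>
     D = (\<Union>k. dyadic_generation D k) \<and>
     (\<forall>k. partition_on UNIV (dyadic_generation D k)) \<and>
     (\<forall>Q\<in>D. \<forall>R\<in>D. Q \<inter> R \<in> {Q, R, {}})"

definition sparse_family :: "real \<Rightarrow> (real^'n) set set \<Rightarrow> bool" where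
  "sparse_family \<gamma> S \<longleftrightarrow>
     (\<exists>E. (\<forall>Q\<in>S. E Q \<in> sets lebesgue \<and> E Q \<subseteq> Q \<and>
                  measure lebesgue (E Q) \<ge> \<gamma> * measure lebesgue Q) \<and>
          disjoint_family_on E S)"

(* Only used for g \<ge> 0; ennreal truncates negative values to 0. *)
definition frac_avg :: "real \<Rightarrow> (real^'n) set \<Rightarrow> (real^'n \<Rightarrow> real) \<Rightarrow> ennreal" where
  "frac_avg \<alpha> Q g =
     (\<integral>\<^sup>+x\<in>Q. ennreal (g x) \<partial>lebesgue)
       / ennreal (measure lebesgue Q powr (1 - \<alpha> / real CARD('n)))"

definition sparse_op ::
  "real \<Rightarrow> real \<Rightarrow> (real^'n) set set \<Rightarrow> (real^'n \<Rightarrow> real) \<Rightarrow> real^'n \<Rightarrow> ennreal" where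
  "sparse_op \<alpha> \<nu> S g x =
     epowr (\<Sum>\<^sub>\<infinity>Q\<in>S. epowr (frac_avg \<alpha> Q g) \<nu> * indicator Q x) (1 / \<nu>)"

definition Lp_norm :: "real \<Rightarrow> 'a measure \<Rightarrow> ('a \<Rightarrow> ennreal) \<Rightarrow> ennreal" where
  "Lp_norm p M g = epowr (\<integral>\<^sup>+x. epowr (g x) p \<partial>M) (1 / p)"

definition weak_Lp_norm :: "real \<Rightarrow> 'a measure \<Rightarrow> ('a \<Rightarrow> ennreal) \<Rightarrow> ennreal" where
  "weak_Lp_norm q M g =
     (SUP t\<in>{0::real<..}. ennreal t * epowr (emeasure M {x \<in> space M. g x > ennreal t}) (1 / q))"

definition weak_op_norm ::
  "real \<Rightarrow> real \<Rightarrow> real \<Rightarrow> real \<Rightarrow> (real^'n) set set \<Rightarrow> (real^'n \<Rightarrow> real) \<Rightarrow> (real^'n \<Rightarrow> real)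
     \<Rightarrow> ennreal" where
  "weak_op_norm p q \<alpha> \<nu> S \<sigma> w =
     Inf {C. \<forall>f. f \<in> borel_measurable lebesgue \<longrightarrow> (\<forall>x. 0 \<le> f x) \<longrightarrow>
               Lp_norm p (weighted \<sigma>) (\<lambda>x. ennreal (f x)) < \<infinity> \<longrightarrow>
               weak_Lp_norm q (weighted w) (sparse_op \<alpha> \<nu> S (\<lambda>x. f x * \<sigma> x))
                 \<le> C * Lp_norm p (weighted \<sigma>) (\<lambda>x. ennreal (f x))}"

definition dual_testing_const ::
  "real \<Rightarrow> real \<Rightarrow> real \<Rightarrow> real \<Rightarrow> (real^'n) set set \<Rightarrow> (real^'n \<Rightarrow> real) \<Rightarrow> (real^'n \<Rightarrow> real)
     \<Rightarrow> ennreal" where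
  "dual_testing_const p q \<alpha> \<nu> S \<sigma> w =
     (SUP R\<in>S. epowr (emeasure (weighted w) R) (- (1 / conj_exp (q / \<nu>)))
        * Lp_norm (conj_exp (p / \<nu>)) (weighted \<sigma>)
            (\<lambda>x. \<Sum>\<^sub>\<infinity>Q\<in>{Q\<in>S. Q \<subseteq> R}.
                   epowr (frac_avg \<alpha> Q \<sigma>) (\<nu> - 1) * frac_avg \<alpha> Q w * indicator Q x))"

end

theory Submission
  imports Defs
begin

text \<open>
  Put \<open>s = p / \<nu>\<close> and \<open>r = q / \<nu>\<close>, so that \<open>1 < s \<le> r\<close>. Dominating averages over \<open>Q\<close> by the values on
  \<open>Q\<close> of the dyadic maximal function with respect to \<open>\<sigma>\<close>, which is bounded on \<open>L\<^sup>p(\<sigma>)\<close> and on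
  \<open>L\<^sup>s(\<sigma>)\<close>, replaces the \<open>\<nu>\<close>-th power of the sparse operator by the positive linear operator
  \<open>g \<mapsto> \<Sum>Q. c Q (\<integral>\<^bsub>Q\<^esub> g d\<sigma>) 1\<^bsub>Q\<^esub>\<close> from \<open>L\<^sup>s(\<sigma>)\<close> to weak \<open>L\<^sup>r(w)\<close>.

  Testing is necessary by duality: the testing function \<open>h\<close> is paired with \<open>g = h\<^bsup>s' - 1\<^esup>\<close>, and
  the weak bound is integrated over \<open>R\<close> (Kolmogorov's inequality).
  For sufficiency, on a maximal cube \<open>R\<close> of the superlevel set at height \<open>t\<close>, the cubes above \<open>R\<close>
  contribute at most \<open>t\<close>, so at height \<open>2t\<close> only the cubes inside \<open>R\<close> matter; Hoelder's
  inequality and the testing condition bound the mass of those \<open>R\<close> of which a fixed proportion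
  survives at height \<open>2t\<close>, and \<open>s \<le> r\<close> allows summing over \<open>R\<close>.

  Monotone convergence along finite subfamilies reduces both directions to finite families.
\<close>

section \<open>Powers and integral inequalities on \<open>[0, \<infinity>]\<close>\<close>

lemma epowr_ennreal: "0 < a \<Longrightarrow> 0 \<le> x \<Longrightarrow> epowr (ennreal x) a = ennreal (x powr a)"
  by (simp add: epowr_def)

lemma epowr_top [simp]: "0 < a \<Longrightarrow> epowr \<infinity> a = \<infinity>" "0 < a \<Longrightarrow> epowr top a = top"
  by (simp_all add: epowr_def)

lemma epowr_0 [simp]: "0 < a \<Longrightarrow> epowr 0 a = 0"
  by (simp add: epowr_def)

lemma epowr_one [simp]: "epowr x 1 = x"
  by (cases x) (simp_all add: epowr_def top_ennreal.rep_eq)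

lemma epowr_1_left [simp]: "epowr 1 a = 1"
  by (simp add: epowr_def)

lemma epowr_real: "0 < x \<Longrightarrow> epowr (ennreal x) a = ennreal (x powr a)"
  by (auto simp: epowr_def inverse_ennreal powr_minus)

lemma epowr_mono:
  assumes "0 < a" "x \<le> y" shows "epowr x a \<le> epowr y a"
proof (cases "y = \<infinity>")
  case False
  then obtain r where "y = ennreal r" "0 \<le> r" by (cases y) auto
  moreover obtain s where "x = ennreal s" "0 \<le> s" using assms calculation
    by (cases x) (auto simp: top_unique)
  ultimately show ?thesis using assms
    by (simp add: epowr_ennreal powr_mono2)
qed (use assms in simp)

lemma epowr_epowr:
  assumes "0 < a" "0 < b" shows "epowr (epowr x a) b = epowr x (a * b)"
  using assms by (cases x) (simp_all add: epowr_ennreal powr_powr)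

lemma epowr_inverse:
  assumes "0 < a" shows "epowr (epowr x a) (1 / a) = x" "epowr (epowr x (1 / a)) a = x"
  using assms by (simp_all add: epowr_epowr)

lemma epowr_le_iff: "0 < a \<Longrightarrow> epowr x a \<le> epowr y a \<longleftrightarrow> x \<le> y"
  using epowr_mono[of a x y] epowr_mono[of "1/a" "epowr x a" "epowr y a"]
  by (auto simp: epowr_inverse)

lemma epowr_less_iff: "0 < a \<Longrightarrow> epowr x a < epowr y a \<longleftrightarrow> x < y"
  using epowr_le_iff[of a y x] by (simp flip: not_le)

lemma epowr_le_iff_le_epowr: "0 < a \<Longrightarrow> epowr x a \<le> y \<longleftrightarrow> x \<le> epowr y (1 / a)"
  using epowr_le_iff[of a x "epowr y (1/a)"] by (simp add: epowr_inverse)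

lemma le_epowr_iff_epowr_le: "0 < a \<Longrightarrow> y \<le> epowr x a \<longleftrightarrow> epowr y (1 / a) \<le> x"
  using epowr_le_iff[of a "epowr y (1/a)" x] by (simp add: epowr_inverse)

lemma epowr_eq_0_iff [simp]: "0 < a \<Longrightarrow> epowr x a = 0 \<longleftrightarrow> x = 0"
  using epowr_le_iff[of a x 0] by simp

lemma epowr_eq_top_iff [simp]: "0 < a \<Longrightarrow> epowr x a = top \<longleftrightarrow> x = top"
  using epowr_le_iff[of a top x] by (simp add: top_unique)

lemma epowr_less_top_iff [simp]: "0 < a \<Longrightarrow> epowr x a < top \<longleftrightarrow> x < top"
  by (simp add: less_top[symmetric])

lemma epowr_mult:
  assumes "0 < a" shows "epowr (x * y) a = epowr x a * epowr y a"
proof (cases "x = 0 \<or> y = 0 \<or> x = top \<or> y = top")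
  case True
  then show ?thesis using assms by (auto simp: ennreal_mult_eq_top_iff ennreal_top_mult ennreal_mult_top)
next
  case False
  then obtain r s where "x = ennreal r" "y = ennreal s" "0 \<le> r" "0 \<le> s"
    by (cases x; cases y) auto
  then show ?thesis using assms
    by (simp add: epowr_ennreal powr_mult flip: ennreal_mult)
qed

lemma epowr_add:
  assumes "0 < a" "0 < b" shows "epowr x (a + b) = epowr x a * epowr x b"
  using assms by (cases x) (simp_all add: epowr_ennreal powr_add ennreal_top_mult flip: ennreal_mult)

text \<open>A positive power is an order isomorphism of [0, \<infinity>] and so commutes with
  suprema; \<open>epowr_le_iff_le_epowr\<close> carries upper bounds from one side to the
  other.\<close>

lemma epowr_Sup:
  assumes "0 < a" "A \<noteq> {}"
  shows "epowr (SUP i\<in>A. f i) a = (SUP i\<in>A. epowr (f i) a)"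
proof (rule antisym)
  show "epowr (SUP i\<in>A. f i) a \<le> (SUP i\<in>A. epowr (f i) a)"
    unfolding epowr_le_iff_le_epowr[OF assms(1)]
    by (intro SUP_least, subst epowr_le_iff_le_epowr[OF assms(1), symmetric]) (rule SUP_upper)
  show "(SUP i\<in>A. epowr (f i) a) \<le> epowr (SUP i\<in>A. f i) a"
    by (intro SUP_least epowr_mono assms SUP_upper)
qed

lemma epowr_indicator [simp]: "0 < a \<Longrightarrow> epowr (indicator A x) a = indicator A x"
  by (simp add: indicator_def)

lemma measurable_epowr [measurable]:
  assumes [measurable]: "f \<in> borel_measurable M"
  shows "(\<lambda>x. epowr (f x) a) \<in> borel_measurable M"
  unfolding epowr_def Let_def by measurable

text \<open>One factor of each term is kept, and the remaining power e - 1 is enlarged to that of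
  the total. With e = r / s this later sums local estimates, by s \<le> r.\<close>

lemma sum_epowr_le:
  assumes "finite I" "1 \<le> e"
  shows "(\<Sum>i\<in>I. epowr (f i) e) \<le> epowr (\<Sum>i\<in>I. f i) e"
proof (cases "e = 1")
  case False
  then have e: "0 < e - 1" using assms by simp
  have split: "epowr x e = epowr x (e - 1) * x" for x
    using epowr_add[of "e - 1" 1 x] e by simp
  have "(\<Sum>i\<in>I. epowr (f i) e) \<le> (\<Sum>i\<in>I. epowr (\<Sum>i\<in>I. f i) (e - 1) * f i)"
    unfolding split
    by (intro sum_mono mult_right_mono epowr_mono e member_le_sum assms(1)) auto
  then show ?thesis by (simp add: split sum_distrib_left)
qed simp

section \<open>Young's and Hoelder's inequalities\<close>

lemma Youngs_inequality_ennreal: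
  assumes "1 < p" "1 < p'" "1/p + 1/p' = 1"
  shows "x * y \<le> ennreal (1/p) * epowr x p + ennreal (1/p') * epowr y p'"
proof (cases "x = top \<or> y = top")
  case True
  then show ?thesis using assms by (auto simp: ennreal_mult_top ennreal_top_mult)
next
  case False
  then obtain r s where "x = ennreal r" "y = ennreal s" "0 \<le> r" "0 \<le> s"
    by (cases x; cases y) auto
  then show ?thesis using assms Youngs_inequality[of p p' r s]
    by (simp add: epowr_ennreal flip: ennreal_mult ennreal_plus)
qed

text \<open>In the main case \<open>u\<close> and \<open>v\<close> scale both integrals to 1 and
  Young's inequality is integrated. A vanishing integral forces f g = 0 almost everywhere; if
  neither vanishes, an infinite one makes the right side infinite.\<close>

lemma Hoelder_inequality_nn:
  assumes pq: "1 < p" "1 < p'" "1/p + 1/p' = 1"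
    and [measurable]: "f \<in> borel_measurable M" "g \<in> borel_measurable M"
  shows "(\<integral>\<^sup>+x. f x * g x \<partial>M) \<le>
     epowr (\<integral>\<^sup>+x. epowr (f x) p \<partial>M) (1/p) * epowr (\<integral>\<^sup>+x. epowr (g x) p' \<partial>M) (1/p')"
    (is "_ \<le> epowr ?A _ * epowr ?B _")
proof -
  have pos: "0 < p" "0 < p'" using pq by auto
  consider "?A = 0 \<or> ?B = 0" | "?A \<noteq> 0" "?B \<noteq> 0" "?A = top \<or> ?B = top"
    | "?A \<noteq> 0" "?B \<noteq> 0" "?A \<noteq> top" "?B \<noteq> top" by blast
  then show ?thesis
  proof cases
    case 1
    then have "AE x in M. f x * g x = 0"
    proof
      assume "?A = 0"
      then show ?thesis using pos by (subst (asm) nn_integral_0_iff_AE) auto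
    next
      assume "?B = 0"
      then show ?thesis using pos by (subst (asm) nn_integral_0_iff_AE) auto
    qed
    then have "(\<integral>\<^sup>+x. f x * g x \<partial>M) = 0" by (subst nn_integral_0_iff_AE) auto
    then show ?thesis by simp
  next
    case 2
    then show ?thesis using pos by (auto simp: ennreal_mult_top ennreal_top_mult)
  next
    case 3
    then obtain a b where ab: "?A = ennreal a" "?B = ennreal b" "0 < a" "0 < b"
      by (cases ?A; cases ?B) auto
    define u where "u = a powr (- (1/p))"
    define v where "v = b powr (- (1/p'))"
    have uv: "0 < u" "0 < v" using ab by (auto simp: u_def v_def)
    have "u powr p = inverse a" "v powr p' = inverse b"
      using ab pos by (simp_all add: u_def v_def powr_powr powr_minus_divide divide_simps powr_divide)
    then have ua: "epowr (ennreal u) p * ?A = 1" and vb: "epowr (ennreal v) p' * ?B = 1"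
      using ab pos uv by (simp_all add: epowr_ennreal flip: ennreal_mult)
    have "ennreal (u * v) * (\<integral>\<^sup>+x. f x * g x \<partial>M) = (\<integral>\<^sup>+x. (ennreal u * f x) * (ennreal v * g x) \<partial>M)"
      using uv by (subst nn_integral_cmult[symmetric]) (auto simp: ennreal_mult mult_ac)
    also have "\<dots> \<le> (\<integral>\<^sup>+x. ennreal (1/p) * epowr (ennreal u * f x) p
                       + ennreal (1/p') * epowr (ennreal v * g x) p' \<partial>M)"
      by (intro nn_integral_mono Youngs_inequality_ennreal pq)
    also have "\<dots> = ennreal (1/p) * (epowr (ennreal u) p * ?A) + ennreal (1/p') * (epowr (ennreal v) p' * ?B)"
      using pos by (simp add: nn_integral_add nn_integral_cmult epowr_mult)
    also have "\<dots> = 1"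
      unfolding ua vb using pos pq(3) by (simp flip: ennreal_plus)
    finally have le: "ennreal (u * v) * (\<integral>\<^sup>+x. f x * g x \<partial>M) \<le> 1" .
    have uv1: "a powr (1/p) * b powr (1/p') * (u * v) = 1"
      using ab by (simp add: u_def v_def powr_minus field_simps)
    have "(\<integral>\<^sup>+x. f x * g x \<partial>M) = ennreal (a powr (1/p) * b powr (1/p') * (u * v)) * (\<integral>\<^sup>+x. f x * g x \<partial>M)"
      unfolding uv1 by simp
    also have "\<dots> = ennreal (a powr (1/p) * b powr (1/p')) * (ennreal (u * v) * (\<integral>\<^sup>+x. f x * g x \<partial>M))"
      using uv by (subst ennreal_mult) (auto simp: mult.assoc)
    also have "\<dots> \<le> ennreal (a powr (1/p) * b powr (1/p')) * 1"
      by (intro mult_left_mono le) auto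
    finally show ?thesis using ab pos by (simp add: epowr_ennreal ennreal_mult)
  qed
qed

text \<open>Tonelli's theorem on the product with \<open>lborel\<close>. In the maximal theorem
  \<open>f\<close> is 1 on the way to level sets and the function itself on the way back; in
  \<open>Kolmogorov_inequality\<close> it is the indicator of \<open>R\<close>.\<close>

lemma layer_cake:
  fixes k :: "real \<Rightarrow> ennreal"
  assumes "sigma_finite_measure M"
    and [measurable]: "f \<in> borel_measurable M" "u \<in> borel_measurable M" "k \<in> borel_measurable borel"
  shows "(\<integral>\<^sup>+x. f x * (\<integral>\<^sup>+t. k t * indicator {t. ennreal t < u x} t \<partial>lborel) \<partial>M) =
         (\<integral>\<^sup>+t. k t * (\<integral>\<^sup>+x. f x * indicator {x. ennreal t < u x} x \<partial>M) \<partial>lborel)"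
proof -
  interpret sigma_finite_measure M by fact
  interpret pair_sigma_finite M lborel
    by (simp add: pair_sigma_finite_def sigma_finite_measure_axioms sigma_finite_lborel)
  have [measurable]: "Measurable.pred (M \<Otimes>\<^sub>M borel) (\<lambda>z. ennreal (snd z) < u (fst z))"
    by measurable
  have [measurable]: "Measurable.pred M (\<lambda>x. ennreal t < u x)" for t by measurable
  have "(\<integral>\<^sup>+x. f x * (\<integral>\<^sup>+t. k t * indicator {t. ennreal t < u x} t \<partial>lborel) \<partial>M) =
        (\<integral>\<^sup>+x. (\<integral>\<^sup>+t. f x * k t * indicator {z. ennreal (snd z) < u (fst z)} (x, t) \<partial>lborel) \<partial>M)"
    by (subst nn_integral_cmult[symmetric]) (auto simp: mult.assoc indicator_def intro!: nn_integral_cong)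
  also have "\<dots> = (\<integral>\<^sup>+t. (\<integral>\<^sup>+x. f x * k t * indicator {z. ennreal (snd z) < u (fst z)} (x, t) \<partial>M) \<partial>lborel)"
    by (rule Fubini'[symmetric]) (measurable)
  also have "\<dots> = (\<integral>\<^sup>+t. k t * (\<integral>\<^sup>+x. f x * indicator {x. ennreal t < u x} x \<partial>M) \<partial>lborel)"
    by (intro nn_integral_cong, subst nn_integral_cmult[symmetric])
       (auto simp: mult_ac indicator_def intro!: nn_integral_cong)
  finally show ?thesis .
qed

lemma nn_integral_powr_0:
  assumes "0 < a" "u < top"
  shows "(\<integral>\<^sup>+t. ennreal (t powr (a - 1)) * indicator {0<..} t * indicator {t. ennreal t < u} t \<partial>lborel) =
     epowr u a / ennreal a"
proof -
  obtain c where c: "u = ennreal c" "0 \<le> c" using assms(2) by (cases u) auto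
  have "(\<integral>\<^sup>+t. ennreal (t powr (a - 1)) * indicator {0<..} t * indicator {t. ennreal t < u} t \<partial>lborel) =
        (\<integral>\<^sup>+t. ennreal (t powr (a - 1)) * indicator {0..c} t \<partial>lborel)"
  proof (intro nn_integral_cong_AE)
    \<comment> \<open>The integrands differ at most at the endpoints 0 and c, a null set. Since
      \<open>ennreal\<close> sends negative t to 0, the indicator of \<open>{0<..}\<close> has to
      cut those t off.\<close>
    have "AE t in lborel. t \<noteq> c \<and> t \<noteq> (0::real)"
      by (auto intro: AE_lborel_singleton)
    then show "AE t in lborel. ennreal (t powr (a - 1)) * indicator {0<..} t * indicator {t. ennreal t < u} t
                 = ennreal (t powr (a - 1)) * indicator {0..c} t"
      by eventually_elim (use c in \<open>auto simp: indicator_def ennreal_less_iff not_less\<close>)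
  qed
  also have "\<dots> = ennreal (c powr a / a)"
    using nn_integral_has_integral_lebesgue'[OF _ has_integral_powr_from_0[of "a - 1" c]] assms c
    by auto
  finally show ?thesis using assms c by (simp add: epowr_ennreal divide_ennreal)
qed

lemma ennreal_mult_le_cancel_right:
  fixes a b c :: ennreal
  assumes "a * c \<le> b * c" "c \<noteq> 0" "c < top" shows "a \<le> b"
  using assms ennreal_mult_le_mult_iff[of c a b] by (simp add: mult.commute less_top)

lemma ennreal_times_divide_cancel:
  fixes c x :: ennreal
  assumes "c \<noteq> 0" "c < top" shows "c * (x / c) = x" "x / c * c = x"
  using assms by (simp_all add: ennreal_divide_times mult.commute[of c])

text \<open>Divide by X^(1 - 1/p). The cancellation needs X < \<infinity>, which is why
  \<open>mx_strong\<close> and \<open>lower_finite\<close> settle finiteness first.\<close>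

lemma le_epowr_absorb:
  assumes "1 < p" "X < top" "X \<le> K * epowr X (1 - 1 / p)"
  shows "X \<le> epowr K p"
proof (cases "X = 0")
  case False
  have "0 < 1 - 1 / p" "0 < 1 / p" using assms(1) by auto
  then have "epowr X (1 / p) * epowr X (1 - 1 / p) \<le> K * epowr X (1 - 1 / p)"
    using assms(3) epowr_add[of "1 / p" "1 - 1 / p" X] by simp
  moreover have "epowr X (1 - 1 / p) \<noteq> 0" "epowr X (1 - 1 / p) < top"
    using False assms \<open>0 < 1 - 1 / p\<close> by auto
  ultimately have "epowr X (1 / p) \<le> K"
    by (rule ennreal_mult_le_cancel_right)
  then show ?thesis using assms(1) by (simp add: epowr_le_iff_le_epowr)
qed simp

section \<open>Laminar families and the maximal function\<close>

definition laminar :: "'a set set \<Rightarrow> bool" where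
  "laminar F \<longleftrightarrow> (\<forall>Q\<in>F. \<forall>R\<in>F. Q \<inter> R \<in> {Q, R, {}})"

definition maximal_sets :: "'a set set \<Rightarrow> 'a set set" where
  "maximal_sets F = {Q \<in> F. \<forall>R\<in>F. Q \<subseteq> R \<longrightarrow> R = Q}"

lemma maximal_sets_subset: "maximal_sets F \<subseteq> F"
  by (auto simp: maximal_sets_def)

lemma Union_maximal_sets:
  assumes "finite F" shows "\<Union>(maximal_sets F) = \<Union>F"
proof -
  have "\<exists>R\<in>maximal_sets F. Q \<subseteq> R" if "Q \<in> F" for Q
    using finite_has_maximal2[OF assms that] by (auto simp: maximal_sets_def)
  then show ?thesis using maximal_sets_subset by blast
qed

lemma disjoint_maximal_sets: "laminar F \<Longrightarrow> disjoint (maximal_sets F)"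
  unfolding laminar_def maximal_sets_def disjoint_def by (simp add: Int_absorb1) (metis Int_lower1 Int_lower2)

lemma laminar_subset: "laminar F \<Longrightarrow> G \<subseteq> F \<Longrightarrow> laminar G"
  by (auto simp: laminar_def)

lemma nn_integral_Union_disjoint:
  assumes "finite G" "disjoint G" "G \<subseteq> sets M" and [measurable]: "f \<in> borel_measurable M"
  shows "(\<integral>\<^sup>+x. f x * indicator (\<Union>G) x \<partial>M) = (\<Sum>Q\<in>G. \<integral>\<^sup>+x. f x * indicator Q x \<partial>M)"
proof -
  have "disjoint_family_on (\<lambda>Q. Q) G"
    using assms(2) by (simp add: disjoint_family_on_def disjoint_def)
  from indicator_UN_disjoint[OF assms(1) this]
  have "indicator (\<Union>G) x = (\<Sum>Q\<in>G. indicator Q x :: ennreal)" for x by simp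
  moreover have "(\<lambda>x. f x * indicator Q x) \<in> borel_measurable M" if "Q \<in> G" for Q
    using assms(3) that by (intro borel_measurable_times_ennreal borel_measurable_indicator) auto
  ultimately show ?thesis
    by (simp add: sum_distrib_left nn_integral_sum)
qed

text \<open>Dyadic cubes seen through one measure; the same family is later used with \<sigma> and
  with w. Finiteness provides maximal members, and positive finite measures allow averages to be
  multiplied out.\<close>

locale laminar_family = sigma_finite_measure M for M :: "'a measure" +
  fixes F :: "'a set set"
  assumes finite_F [simp, intro]: "finite F"
    and laminar_F: "laminar F"
    and sets_F [measurable, intro]: "Q \<in> F \<Longrightarrow> Q \<in> sets M"
    and pos_F: "Q \<in> F \<Longrightarrow> 0 < emeasure M Q"
    and fin_F: "Q \<in> F \<Longrightarrow> emeasure M Q < top"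
begin

section \<open>The maximal function of a laminar family\<close>

definition avg :: "('a \<Rightarrow> ennreal) \<Rightarrow> 'a set \<Rightarrow> ennreal" where
  "avg f Q = (\<integral>\<^sup>+x. f x * indicator Q x \<partial>M) / emeasure M Q"

definition mx :: "('a \<Rightarrow> ennreal) \<Rightarrow> 'a \<Rightarrow> ennreal" where
  "mx f x = (SUP Q\<in>F. avg f Q * indicator Q x)"

lemma measurable_mx [measurable]: "mx f \<in> borel_measurable M"
  unfolding mx_def[abs_def] by (intro borel_measurable_SUP countable_finite) auto

lemma avg_le_mx: "Q \<in> F \<Longrightarrow> x \<in> Q \<Longrightarrow> avg f Q \<le> mx f x"
  unfolding mx_def by (rule SUP_upper2[of Q]) auto

lemma avg_mult: "Q \<in> F \<Longrightarrow> avg f Q * emeasure M Q = (\<integral>\<^sup>+x. f x * indicator Q x \<partial>M)"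
  using pos_F[of Q] fin_F[of Q] unfolding avg_def
  by (simp add: ennreal_divide_times)

lemma le_avg:
  assumes "Q \<in> F" "\<And>x. x \<in> Q \<Longrightarrow> c \<le> f x" shows "c \<le> avg f Q"
proof -
  have "c * emeasure M Q = (\<integral>\<^sup>+x. c * indicator Q x \<partial>M)"
    using assms by (simp add: nn_integral_cmult_indicator sets_F)
  also have "\<dots> \<le> (\<integral>\<^sup>+x. f x * indicator Q x \<partial>M)"
    using assms by (intro nn_integral_mono) (auto simp: indicator_def)
  also have "\<dots> = avg f Q * emeasure M Q" by (simp add: avg_mult assms)
  finally show ?thesis
    using pos_F[of Q] fin_F[of Q] assms by (intro ennreal_mult_le_cancel_right[of c "emeasure M Q"]) auto
qed

lemma less_mx_iff: "ennreal t < mx f x \<longleftrightarrow> x \<in> \<Union>{Q \<in> F. ennreal t < avg f Q}"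
  by (auto simp: mx_def less_SUP_iff indicator_def split: if_splits)

text \<open>The level set is the disjoint union of the maximal members with average above t, and on
  each of them the bound is the definition of the average. The right side keeps f only on the level
  set, as the L^p argument requires.\<close>

lemma mx_weak:
  assumes [measurable]: "f \<in> borel_measurable M"
  shows "ennreal t * (\<integral>\<^sup>+x. 1 * indicator {x. ennreal t < mx f x} x \<partial>M) \<le>
         (\<integral>\<^sup>+x. f x * indicator {x. ennreal t < mx f x} x \<partial>M)"
proof -
  define G where "G = maximal_sets {Q \<in> F. ennreal t < avg f Q}"
  have GF: "G \<subseteq> F" "\<And>Q. Q \<in> G \<Longrightarrow> ennreal t \<le> avg f Q"
    using maximal_sets_subset by (force simp: G_def)+
  then have G: "finite G" "G \<subseteq> sets M" by (auto intro: finite_subset)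
  have "disjoint G" unfolding G_def by (intro disjoint_maximal_sets laminar_subset[OF laminar_F]) auto
  note U = nn_integral_Union_disjoint[OF G(1) this G(2)]
  have eq: "{x. ennreal t < mx f x} = \<Union>G"
    by (auto simp: less_mx_iff G_def Union_maximal_sets)
  have "ennreal t * (\<integral>\<^sup>+x. 1 * indicator Q x \<partial>M) \<le> (\<integral>\<^sup>+x. f x * indicator Q x \<partial>M)" if "Q \<in> G" for Q
    using GF that by (subst avg_mult[symmetric]) (auto simp: sets_F subset_eq intro!: mult_right_mono)
  then show ?thesis unfolding eq
    using U[of f] U[of "\<lambda>_. 1"] by (simp add: sum_distrib_left sum_mono)
qed

lemma avg_less_top:
  assumes p: "1 < p" and [measurable]: "f \<in> borel_measurable M"
    and fin: "(\<integral>\<^sup>+x. epowr (f x) p \<partial>M) < top" and Q: "Q \<in> F"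
  shows "avg f Q < top"
proof -
  have [measurable]: "Q \<in> sets M" using Q by auto
  define p' where "p' = p / (p - 1)"
  have p': "1 < p'" "1/p + 1/p' = 1" using p by (auto simp: p'_def field_simps)
  have "(\<integral>\<^sup>+x. f x * indicator Q x \<partial>M) \<le> epowr (\<integral>\<^sup>+x. epowr (f x) p \<partial>M) (1/p) *
        epowr (\<integral>\<^sup>+x. epowr (indicator Q x) p' \<partial>M) (1/p')"
    by (intro Hoelder_inequality_nn p p') auto
  also have "\<dots> < top"
    using p p' fin fin_F[OF Q] by (auto simp: ennreal_mult_less_top)
  finally show ?thesis unfolding avg_def using pos_F[OF Q]
    by (auto simp: ennreal_divide_eq_top_iff less_top[symmetric])
qed

text \<open>A crude bound of a supremum by a sum. Its size depends on \<open>F\<close>, so it serves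
  only for finiteness, in \<open>mx_less_top\<close> and \<open>mx_strong\<close>.\<close>

lemma epowr_mx_le:
  assumes "0 < p" shows "epowr (mx f x) p \<le> (\<Sum>Q\<in>F. epowr (avg f Q) p * indicator Q x)"
proof (cases "F = {}")
  case False
  then have "epowr (mx f x) p = (SUP Q\<in>F. epowr (avg f Q) p * indicator Q x)"
    using assms by (simp add: mx_def epowr_Sup epowr_mult)
  also have "\<dots> \<le> (\<Sum>Q\<in>F. epowr (avg f Q) p * indicator Q x)"
    by (intro SUP_least member_le_sum) auto
  finally show ?thesis .
next
  case True
  have "mx f x = 0" unfolding mx_def using True by (simp add: bot_ennreal)
  then show ?thesis using assms by simp
qed

lemma mx_less_top:
  assumes "\<And>Q. Q \<in> F \<Longrightarrow> avg f Q < top" shows "mx f x < top"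
proof -
  have "mx f x \<le> (\<Sum>Q\<in>F. avg f Q * indicator Q x)"
    using epowr_mx_le[of 1 f x] by simp
  also have "\<dots> < top"
    using assms by (subst ennreal_sum_less_top) (auto simp: indicator_def)
  finally show ?thesis .
qed

text \<open>Doob's argument: the weak estimate is integrated against p t^(p-1), Hoelder's inequality
  gives X \<le> p' A^(1/p) X^(1-1/p), and X is absorbed. The constant does not depend on
  \<open>F\<close>, which later permits the passage to infinite families.\<close>

lemma mx_strong:
  assumes p: "1 < p" and [measurable]: "f \<in> borel_measurable M"
  shows "(\<integral>\<^sup>+x. epowr (mx f x) p \<partial>M) \<le> ennreal ((p / (p - 1)) powr p) * (\<integral>\<^sup>+x. epowr (f x) p \<partial>M)"
    (is "?X \<le> _ * ?A")
proof (cases "?A = top")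
  case True
  then show ?thesis using p by (simp add: ennreal_mult_top)
next
  case False
  then have fin: "avg f Q < top" if "Q \<in> F" for Q
    using avg_less_top[OF p assms(2) _ that] by (simp add: less_top)
  have mxfin: "mx f x < top" for x by (rule mx_less_top) (rule fin)
  \<comment> \<open>\<open>?X\<close> must be finite before it can be absorbed: finiteness of
    \<open>?A\<close> makes each average finite, and there are finitely many.\<close>
  have "?X \<le> (\<integral>\<^sup>+x. (\<Sum>Q\<in>F. epowr (avg f Q) p * indicator Q x) \<partial>M)"
    using p by (intro nn_integral_mono epowr_mx_le) auto
  also have "\<dots> = (\<Sum>Q\<in>F. epowr (avg f Q) p * emeasure M Q)"
    by (subst nn_integral_sum) (auto simp: nn_integral_cmult_indicator sets_F intro!: sum.cong)
  also have "\<dots> < top"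
    using p fin fin_F by (subst ennreal_sum_less_top) (auto simp: ennreal_mult_less_top)
  finally have Xfin: "?X < top" .
  let ?k = "\<lambda>a t. ennreal (t powr a) * indicator {0<..} t"
  have pw: "(\<integral>\<^sup>+t. ?k (a - 1) t * indicator {t. ennreal t < mx f x} t \<partial>lborel)
      = epowr (mx f x) a / ennreal a" if "0 < a" for a x
    using nn_integral_powr_0[OF that mxfin] .
  have "?X = (\<integral>\<^sup>+x. ennreal p * (epowr (mx f x) p / ennreal p) \<partial>M)"
    using p by (subst ennreal_times_divide_cancel) auto
  also have "\<dots> = ennreal p * (\<integral>\<^sup>+x. 1 * (\<integral>\<^sup>+t. ?k (p - 1) t * indicator {t. ennreal t < mx f x} t \<partial>lborel) \<partial>M)"
    using p by (subst pw) (auto intro: nn_integral_cmult)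
  also have "\<dots> = ennreal p * (\<integral>\<^sup>+t. ?k (p - 1) t * (\<integral>\<^sup>+x. 1 * indicator {x. ennreal t < mx f x} x \<partial>M) \<partial>lborel)"
    by (subst layer_cake) (auto intro: sigma_finite_measure_axioms)
  \<comment> \<open>One factor t is split off the weight to match the left side of
    \<open>mx_weak\<close>.\<close>
  also have "\<dots> = ennreal p * (\<integral>\<^sup>+t. ?k (p - 1 - 1) t * (ennreal t * (\<integral>\<^sup>+x. 1 * indicator {x. ennreal t < mx f x} x \<partial>M)) \<partial>lborel)"
  proof -
    have *: "?k (p - 1) t = ?k (p - 1 - 1) t * ennreal t" for t
      using powr_add[of t "p - 1 - 1" 1] by (auto simp: indicator_def simp flip: ennreal_mult)
    show ?thesis by (simp only: * mult.assoc)
  qed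
  also have "\<dots> \<le> ennreal p * (\<integral>\<^sup>+t. ?k (p - 1 - 1) t * (\<integral>\<^sup>+x. f x * indicator {x. ennreal t < mx f x} x \<partial>M) \<partial>lborel)"
    by (intro mult_left_mono nn_integral_mono mx_weak assms) auto
  also have "\<dots> = ennreal p * (\<integral>\<^sup>+x. f x * (\<integral>\<^sup>+t. ?k (p - 1 - 1) t * indicator {t. ennreal t < mx f x} t \<partial>lborel) \<partial>M)"
    by (subst layer_cake) (auto intro: sigma_finite_measure_axioms)
  also have "\<dots> = ennreal p * (\<integral>\<^sup>+x. ennreal (1 / (p - 1)) * (f x * epowr (mx f x) (p - 1)) \<partial>M)"
    using p by (subst pw) (auto simp: divide_ennreal_def inverse_ennreal inverse_eq_divide mult_ac)
  also have "\<dots> = ennreal (p / (p - 1)) * (\<integral>\<^sup>+x. f x * epowr (mx f x) (p - 1) \<partial>M)"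
    using p by (subst nn_integral_cmult) (auto simp: mult.assoc[symmetric] simp flip: ennreal_mult)
  \<comment> \<open>The conjugate exponent turns the power p - 1 of \<open>mx f\<close> back into p,
    so \<open>?X\<close> reappears.\<close>
  also have "\<dots> \<le> ennreal (p / (p - 1)) * (epowr ?A (1 / p) *
      epowr (\<integral>\<^sup>+x. epowr (epowr (mx f x) (p - 1)) (p / (p - 1)) \<partial>M) (1 / (p / (p - 1))))"
    using p by (intro mult_left_mono Hoelder_inequality_nn) (auto simp: field_simps)
  also have "\<dots> = (ennreal (p / (p - 1)) * epowr ?A (1 / p)) * epowr ?X (1 - 1 / p)"
    using p by (simp add: epowr_epowr mult.assoc diff_divide_distrib)
  finally have "?X \<le> epowr (ennreal (p / (p - 1)) * epowr ?A (1 / p)) p"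
    by (rule le_epowr_absorb[OF p Xfin])
  also have "\<dots> = ennreal ((p / (p - 1)) powr p) * ?A"
    using p by (simp add: epowr_mult epowr_epowr epowr_ennreal)
  finally show ?thesis .
qed

end

section \<open>Weak-type bounds from testing conditions\<close>

text \<open>The distribution function of \<open>u\<close> on \<open>R\<close> is bounded by the mass
  of \<open>R\<close> and, through the weak bound, by (b / t)^r. Integrating the first bound up to
  the height where they meet and the second beyond it gives the factor 1 + 1 / (r - 1) = r / (r -
  1).\<close>

lemma Kolmogorov_inequality:
  assumes sf: "sigma_finite_measure N" and r: "1 < r"
    and [measurable]: "u \<in> borel_measurable N" "R \<in> sets N"
    and ufin: "\<And>x. u x < top" and R: "0 < emeasure N R" "emeasure N R < top"
    and weak: "\<And>t. 0 < t \<Longrightarrow> ennreal t * epowr (emeasure N {x \<in> space N. ennreal t < u x}) (1 / r) \<le> B"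
  shows "(\<integral>\<^sup>+x. u x * indicator R x \<partial>N) \<le> ennreal (r / (r - 1)) * B * epowr (emeasure N R) (1 - 1 / r)"
proof (cases "B = top")
  case True
  then show ?thesis using R r by (simp add: ennreal_mult_top ennreal_top_mult ennreal_mult_eq_top_iff)
next
  case False
  then obtain b where b: "B = ennreal b" "0 \<le> b" by (cases B) auto
  obtain W where W: "emeasure N R = ennreal W" "0 < W" using R by (cases "emeasure N R") auto
  define m where "m t = (\<integral>\<^sup>+x. indicator R x * indicator {x. ennreal t < u x} x \<partial>N)" for t
  have pw: "(\<integral>\<^sup>+t. indicator {0<..} t * indicator {t. ennreal t < u x} t \<partial>lborel) = u x" for x
  proof -
    have "(\<integral>\<^sup>+t. indicator {0<..} t * indicator {t. ennreal t < u x} t \<partial>lborel) =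
      (\<integral>\<^sup>+t. ennreal (t powr (1 - 1)) * indicator {0<..} t * indicator {t. ennreal t < u x} t \<partial>lborel)"
      by (intro nn_integral_cong) (auto simp: indicator_def)
    also have "\<dots> = u x"
      using ennreal_times_divide_cancel(1)[of 1 "u x"] by (subst nn_integral_powr_0[OF _ ufin]) auto
    finally show ?thesis .
  qed
  have "(\<integral>\<^sup>+x. u x * indicator R x \<partial>N) =
      (\<integral>\<^sup>+x. indicator R x * (\<integral>\<^sup>+t. indicator {0<..} t * indicator {t. ennreal t < u x} t \<partial>lborel) \<partial>N)"
    by (simp only: pw mult.commute)
  also have "\<dots> = (\<integral>\<^sup>+t. indicator {0<..} t * m t \<partial>lborel)"
    unfolding m_def by (rule layer_cake[OF sf]) auto
  finally have eq: "(\<integral>\<^sup>+x. u x * indicator R x \<partial>N) = (\<integral>\<^sup>+t. indicator {0<..} t * m t \<partial>lborel)" .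
  have mW: "m t \<le> ennreal W" for t
  proof -
    have "m t \<le> (\<integral>\<^sup>+x. indicator R x \<partial>N)"
      unfolding m_def by (intro nn_integral_mono) (auto simp: indicator_def)
    then show ?thesis by (simp add: W)
  qed
  have mb: "m t \<le> ennreal (b powr r * t powr (- r))" if t: "0 < t" for t
  proof -
    have "m t \<le> (\<integral>\<^sup>+x. indicator {x \<in> space N. ennreal t < u x} x \<partial>N)"
      unfolding m_def by (intro nn_integral_mono) (auto simp: indicator_def)
    also have "\<dots> = emeasure N {x \<in> space N. ennreal t < u x}" by simp
    also have "\<dots> \<le> epowr (ennreal (b / t)) r"
    proof -
      have "ennreal t * epowr (emeasure N {x \<in> space N. ennreal t < u x}) (1 / r) \<le> ennreal t * ennreal (b / t)"
        using weak[OF t] t b by (simp flip: ennreal_mult)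
      then have "epowr (emeasure N {x \<in> space N. ennreal t < u x}) (1 / r) \<le> ennreal (b / t)"
        using t by (subst (asm) ennreal_mult_le_mult_iff) auto
      then show ?thesis using r by (subst (asm) epowr_le_iff_le_epowr) auto
    qed
    also have "\<dots> = ennreal (b powr r * t powr (- r))"
      using t b r by (simp add: epowr_ennreal powr_divide powr_minus_divide)
    finally show ?thesis .
  qed
  show ?thesis
  proof (cases "b = 0")
    case True
    have "m t = 0" if "0 < t" for t using mb[OF that] True r by simp
    then have "(\<lambda>t. indicator {0<..} t * m t) = (\<lambda>_. 0)" by (simp add: indicator_def fun_eq_iff)
    then show ?thesis unfolding eq by simp
  next
    case False
    then have b0: "0 < b" using b by simp
    \<comment> \<open>The height at which W and b^r t^(-r) coincide; for b = 0 it would degenerate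
      to 0.\<close>
    define t0 where "t0 = b * W powr (- (1/r))"
    have t0: "0 < t0" using b0 W by (simp add: t0_def)
    have "(\<integral>\<^sup>+t. indicator {0<..} t * m t \<partial>lborel) \<le>
      (\<integral>\<^sup>+t. ennreal W * indicator {0..t0} t + ennreal (b powr r) * (ennreal (t powr (-r)) * indicator {t0..} t) \<partial>lborel)"
    proof (intro nn_integral_mono)
      fix t :: real
      show "indicator {0<..} t * m t \<le> ennreal W * indicator {0..t0} t + ennreal (b powr r) * (ennreal (t powr (-r)) * indicator {t0..} t)"
        using mW[of t] mb[of t] t0 by (auto simp: indicator_def ennreal_mult intro: add_increasing2)
    qed
    also have "\<dots> = ennreal W * ennreal t0 + ennreal (b powr r) * ennreal (t0 powr (1 - r) / (r - 1))"
    proof -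
      have "(\<integral>\<^sup>+t. ennreal (t powr (-r)) * indicator {t0..} t \<partial>lborel) = ennreal (- (t0 powr (- r + 1)) / (- r + 1))"
        using r t0 by (intro nn_integral_has_integral_lebesgue' has_integral_powr_to_inf) auto
      also have "- (t0 powr (- r + 1)) / (- r + 1) = t0 powr (1 - r) / (r - 1)"
        using r by (simp add: field_simps)
      finally show ?thesis using t0
        by (simp add: nn_integral_add nn_integral_cmult nn_integral_cmult_indicator)
    qed
    also have "\<dots> = ennreal (W * t0 + b powr r * (t0 powr (1 - r) / (r - 1)))"
      using W t0 r by (simp flip: ennreal_mult ennreal_plus)
    also have "W * t0 + b powr r * (t0 powr (1 - r) / (r - 1)) = r / (r - 1) * b * W powr (1 - 1 / r)"
    proof -
      have 1: "W * t0 = b * W powr (1 - 1/r)"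
        using W powr_add[of W 1 "-(1/r)"] by (simp add: t0_def mult_ac)
      have "b powr r * b powr (1 - r) = b" using b0 by (simp flip: powr_add)
      moreover have "(W powr (- (1/r))) powr (1 - r) = W powr (1 - 1/r)"
      proof -
        have "- (1/r) * (1 - r) = 1 - 1/r" using r by (simp add: field_simps)
        then show ?thesis by (simp only: powr_powr)
      qed
      ultimately have 2: "b powr r * t0 powr (1 - r) = b * W powr (1 - 1/r)"
        using b0 W by (simp add: t0_def powr_mult mult.assoc[symmetric])
      have "W * t0 + b powr r * (t0 powr (1 - r) / (r - 1)) = W * t0 + (b powr r * t0 powr (1 - r)) / (r - 1)"
        by simp
      also have "\<dots> = r / (r - 1) * b * W powr (1 - 1 / r)"
        unfolding 1 2 using r by (simp add: field_simps)
      finally show ?thesis .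
    qed
    finally show ?thesis unfolding eq using b0 W r
      by (simp add: b(1) W(1) epowr_ennreal flip: ennreal_mult)
  qed
qed

text \<open>Here \<phi> plays the role of a distribution function. Multiplying the step by (2 t)^r
  turns the factor 2^(-r-1) into 1/2, so X = sup t^r \<phi>(t) satisfies X \<le> X / 2 + 2^r Z. The
  bounds \<open>m\<close> and \<open>B\<close> make X finite and leave no trace in the
  result.\<close>

lemma good_lambda_absorb:
  fixes \<phi> :: "real \<Rightarrow> real"
  assumes r: "0 < r" and nn: "\<And>t. 0 \<le> \<phi> t" and bd: "\<And>t. \<phi> t \<le> m"
    and B: "0 < B" "\<And>t. B \<le> t \<Longrightarrow> \<phi> t = 0" and Z: "0 \<le> Z"
    and step: "\<And>t. 0 < t \<Longrightarrow> \<phi> (2 * t) \<le> 2 powr (- r - 1) * \<phi> t + Z * t powr (- r)"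
    and t: "0 < t"
  shows "t powr r * \<phi> t \<le> 2 powr (r + 1) * Z"
proof -
  have m: "0 \<le> m" using nn[of 0] bd[of 0] by simp
  define X where "X = (SUP t\<in>{0<..}. t powr r * \<phi> t)"
  have "t powr r * \<phi> t \<le> B powr r * m" if "0 < t" for t
  proof (cases "B \<le> t")
    case False
    then show ?thesis using that r nn bd by (intro mult_mono powr_mono2) auto
  qed (use B m in simp)
  then have bdd: "bdd_above ((\<lambda>t. t powr r * \<phi> t) ` {0<..})"
    by (auto simp: bdd_above_def)
  have le: "t powr r * \<phi> t \<le> X" if "0 < t" for t
    unfolding X_def using that by (intro cSUP_upper bdd) auto
  have "X \<le> X / 2 + 2 powr r * Z"
    unfolding X_def
  proof (rule cSUP_least)
    fix t :: real assume "t \<in> {0<..}"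
    then have t: "0 < t / 2" "t = 2 * (t / 2)" by auto
    have p2: "(t / 2) powr r * (t / 2) powr (- r) = 1" using t by (simp flip: powr_add)
    have "t powr r * \<phi> t = 2 powr r * (t / 2) powr r * \<phi> (2 * (t / 2))"
      using t by (simp flip: powr_mult)
    also have "\<dots> \<le> 2 powr r * (t / 2) powr r * (2 powr (- r - 1) * \<phi> (t / 2) + Z * (t / 2) powr (- r))"
      using step[OF t(1)] by (intro mult_left_mono) auto
    also have "\<dots> = (2 powr r * 2 powr (- r - 1)) * ((t / 2) powr r * \<phi> (t / 2)) + 2 powr r * Z * ((t / 2) powr r * (t / 2) powr (- r))"
      by (simp add: algebra_simps)
    also have "2 powr r * 2 powr (- r - 1) = (1 / 2 :: real)"
      by (simp flip: powr_add add: powr_minus_divide)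
    also have "1 / 2 * ((t / 2) powr r * \<phi> (t / 2)) + 2 powr r * Z * ((t / 2) powr r * (t / 2) powr (- r))
        \<le> X / 2 + 2 powr r * Z"
      unfolding p2 using le[OF t(1)] by simp
    finally show "t powr r * \<phi> t \<le> (SUP t\<in>{0<..}. t powr r * \<phi> t) / 2 + 2 powr r * Z"
      unfolding X_def .
  qed auto
  then have "X \<le> 2 powr (r + 1) * Z" by (simp add: powr_add)
  then show ?thesis using le[OF t] by simp
qed

text \<open>Either n is at most the proportion d of m, or d m < n turns the hypothesis into a bound
  for m itself, hence for n. In the application m is the mass of a maximal set and n the mass of the
  part surviving at height 2 t.\<close>

lemma good_lambda_alternative:
  fixes n m d e \<tau> t r :: real
  assumes "1 < r" "0 < m" "n \<le> m" "0 < d" "0 < t" "0 \<le> e" "0 \<le> \<tau>" "0 < s"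
    and le: "t * n \<le> e powr (1 / s) * (\<tau> * m powr (1 - 1 / r))"
  shows "n \<le> d * m + (\<tau> / d) powr r * t powr (- r) * e powr (r / s)"
proof (cases "n \<le> d * m")
  case True
  moreover have "0 \<le> (\<tau> / d) powr r * t powr (- r) * e powr (r / s)" by auto
  ultimately show ?thesis by linarith
next
  case False
  have "(d * t * m powr (1 / r)) * m powr (1 - 1 / r) = t * (d * m)"
    using assms by (simp add: mult_ac flip: powr_add)
  also have "\<dots> \<le> t * n" using False assms by (intro mult_left_mono) auto
  also have "\<dots> \<le> (e powr (1 / s) * \<tau>) * m powr (1 - 1 / r)" using le by (simp add: mult_ac)
  finally have "d * t * m powr (1 / r) \<le> e powr (1 / s) * \<tau>"
    using assms by simp
  then have "m powr (1 / r) \<le> \<tau> / d * (1 / t) * e powr (1 / s)"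
    using assms by (simp add: field_simps)
  then have "(m powr (1 / r)) powr r \<le> (\<tau> / d * (1 / t) * e powr (1 / s)) powr r"
    using assms by (intro powr_mono2) auto
  also have "\<dots> = (\<tau> / d) powr r * t powr (- r) * e powr (r / s)"
    using assms by (simp only: powr_mult powr_powr) (simp add: powr_divide powr_minus_divide powr_powr)
  finally have "m \<le> (\<tau> / d) powr r * t powr (- r) * e powr (r / s)"
    using assms by (simp add: powr_powr)
  moreover have "0 \<le> d * m" using assms by simp
  ultimately show ?thesis using assms by linarith
qed

text \<open>Pairwise intersecting members of a laminar family form a chain, so a minimal one is
  least. This supplies the smallest member containing a point and the smallest proper ancestor of a
  member.\<close>

lemma exists_minimal_laminar:
  assumes "finite F" "laminar F" "E \<subseteq> F" "E \<noteq> {}" "\<And>Q P. Q \<in> E \<Longrightarrow> P \<in> E \<Longrightarrow> Q \<inter> P \<noteq> {}"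
  shows "\<exists>Q\<in>E. \<forall>P\<in>E. Q \<subseteq> P"
proof -
  have "finite E" using assms by (auto intro: finite_subset)
  from finite_has_minimal[OF this assms(4)] obtain Q where
    Q: "Q \<in> E" "\<And>P. P \<in> E \<Longrightarrow> P \<subseteq> Q \<Longrightarrow> Q = P" by blast
  have "Q \<subseteq> P" if P: "P \<in> E" for P
  proof -
    have "Q \<in> F" "P \<in> F" using Q(1) P assms(3) by auto
    then have "Q \<inter> P \<in> {Q, P, {}}" using assms(2) by (simp add: laminar_def)
    then consider "Q \<inter> P = Q" | "Q \<inter> P = P" using assms(5)[OF Q(1) P] by blast
    then show ?thesis
    proof cases
      case 2
      then have "P \<subseteq> Q" by blast
      then show ?thesis using Q(2)[OF P] by simp
    qed blast
  qed
  then show ?thesis using Q(1) by blast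
qed

context laminar_family
begin

section \<open>Superlevel sets of laminar sums and the good-lambda estimate\<close>

lemma nonempty_F: "Q \<in> F \<Longrightarrow> Q \<noteq> {}"
  using pos_F[of Q] by auto

text \<open>If \<open>Q\<close> is the smallest member containing x, the members containing x are
  exactly those containing \<open>Q\<close>. Superlevel sets are therefore unions of members of
  \<open>F\<close> and can be split into maximal ones.\<close>

lemma superlevel_laminar_sum:
  fixes a :: "'a set \<Rightarrow> ennreal"
  shows "ennreal t < (\<Sum>Q\<in>F. a Q * indicator Q x) \<longleftrightarrow>
    x \<in> \<Union>{Q \<in> F. ennreal t < (\<Sum>P\<in>{P \<in> F. Q \<subseteq> P}. a P)}" (is "?L \<longleftrightarrow> ?R")
proof
  have eq: "(\<Sum>Q\<in>F. a Q * indicator Q x) = (\<Sum>P\<in>{P \<in> F. x \<in> P}. a P)"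
    by (intro sum.mono_neutral_cong_right) (auto simp: indicator_def)
  {
    assume ?L
    then have L: "ennreal t < (\<Sum>P\<in>{P \<in> F. x \<in> P}. a P)" by (simp add: eq)
    then have "{P \<in> F. x \<in> P} \<noteq> {}" by (auto simp del: Collect_empty_eq)
    then obtain Q where Q: "Q \<in> F" "x \<in> Q" "\<And>P. P \<in> F \<Longrightarrow> x \<in> P \<Longrightarrow> Q \<subseteq> P"
      using exists_minimal_laminar[OF finite_F laminar_F, of "{P \<in> F. x \<in> P}"] by blast
    then have "{P \<in> F. x \<in> P} = {P \<in> F. Q \<subseteq> P}" by blast
    then show ?R using L Q by auto
  }
  {
    assume ?R
    then obtain Q where Q: "Q \<in> F" "x \<in> Q" "ennreal t < (\<Sum>P\<in>{P \<in> F. Q \<subseteq> P}. a P)" by blast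
    note Q(3)
    also have "(\<Sum>P\<in>{P \<in> F. Q \<subseteq> P}. a P) \<le> (\<Sum>P\<in>{P \<in> F. x \<in> P}. a P)"
      using Q by (intro sum_mono2) auto
    finally show ?L by (simp add: eq)
  }
qed

text \<open>By maximality of \<open>R\<close>, everything strictly above \<open>R\<close>
  contributes at most t. At height 2 t, more than t is left for the members inside
  \<open>R\<close>.\<close>

lemma localize_laminar_sum:
  fixes a :: "'a set \<Rightarrow> ennreal"
  assumes R: "R \<in> maximal_sets {Q \<in> F. ennreal t < (\<Sum>P\<in>{P \<in> F. Q \<subseteq> P}. a P)}"
    and x: "x \<in> R" and t: "0 \<le> t" "ennreal (2 * t) < (\<Sum>Q\<in>F. a Q * indicator Q x)"
  shows "ennreal t < (\<Sum>Q\<in>{Q \<in> F. Q \<subseteq> R}. a Q * indicator Q x)"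
proof -
  have RF: "R \<in> F" using R by (auto simp: maximal_sets_def)
  have le: "(\<Sum>P\<in>{P \<in> F. R \<subset> P}. a P) \<le> ennreal t"
  proof (cases "{P \<in> F. R \<subset> P} = {}")
    case False
    have "Q \<inter> P \<noteq> {}" if "Q \<in> {P \<in> F. R \<subset> P}" "P \<in> {P \<in> F. R \<subset> P}" for P Q
      using that nonempty_F[OF RF] by blast
    then have "\<exists>Q\<in>{P \<in> F. R \<subset> P}. \<forall>P\<in>{P \<in> F. R \<subset> P}. Q \<subseteq> P"
      by (intro exists_minimal_laminar[OF finite_F laminar_F _ False]) auto
    then obtain Q where Q: "Q \<in> F" "R \<subset> Q" "\<And>P. P \<in> F \<Longrightarrow> R \<subset> P \<Longrightarrow> Q \<subseteq> P"
      by auto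
    \<comment> \<open>The proper ancestors of \<open>R\<close> are precisely the sets above the
      smallest one, which fails the level condition since \<open>R\<close> is maximal.\<close>
    then have "{P \<in> F. R \<subset> P} = {P \<in> F. Q \<subseteq> P}" by blast
    moreover have "\<not> ennreal t < (\<Sum>P\<in>{P \<in> F. Q \<subseteq> P}. a P)"
      using R Q unfolding maximal_sets_def by blast
    ultimately show ?thesis by simp
  qed (simp only: sum.empty zero_le)
  have "(\<Sum>Q\<in>F. a Q * indicator Q x) =
        (\<Sum>Q\<in>{Q \<in> F. Q \<subseteq> R} \<union> {P \<in> F. R \<subset> P}. a Q * indicator Q x)"
  proof (intro sum.mono_neutral_right ballI)
    fix Q assume Q: "Q \<in> F - ({Q \<in> F. Q \<subseteq> R} \<union> {P \<in> F. R \<subset> P})"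
    then have "Q \<inter> R = {}" using laminar_F RF unfolding laminar_def by blast
    then show "a Q * indicator Q x = 0" using x by (auto simp: indicator_def)
  qed auto
  also have "\<dots> = (\<Sum>Q\<in>{Q \<in> F. Q \<subseteq> R}. a Q * indicator Q x) + (\<Sum>Q\<in>{P \<in> F. R \<subset> P}. a Q * indicator Q x)"
    by (intro sum.union_disjoint) auto
  also have "(\<Sum>Q\<in>{P \<in> F. R \<subset> P}. a Q * indicator Q x) = (\<Sum>Q\<in>{P \<in> F. R \<subset> P}. a Q)"
    using x by (intro sum.cong) (auto simp: indicator_def)
  finally have "(\<Sum>Q\<in>F. a Q * indicator Q x) \<le> (\<Sum>Q\<in>{Q \<in> F. Q \<subseteq> R}. a Q * indicator Q x) + ennreal t"
    using le by (simp add: add_left_mono)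
  then have lt: "ennreal (2 * t) < (\<Sum>Q\<in>{Q \<in> F. Q \<subseteq> R}. a Q * indicator Q x) + ennreal t"
    using t by simp
  show ?thesis
  proof (rule ccontr)
    assume "\<not> ?thesis"
    then have "(\<Sum>Q\<in>{Q \<in> F. Q \<subseteq> R}. a Q * indicator Q x) + ennreal t \<le> ennreal t + ennreal t"
      by (intro add_right_mono) simp
    also have "\<dots> = ennreal (2 * t)" using t by (simp flip: ennreal_plus)
    finally show False using lt by simp
  qed
qed

text \<open>Integration over \<open>N\<close> replaces each indicator by
  \<open>emeasure N Q\<close>; exchanging sum and integral then pairs g with the testing function in
  \<open>M\<close>. All of \<open>H\<close> lies in \<open>R\<close>, so g may be cut down to
  \<open>R\<close> before Hoelder's inequality, which makes the bounds for disjoint \<open>R\<close>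
  summable.\<close>

lemma testing_pairing:
  assumes N: "laminar_family N F" "sets N = sets M" and s: "1 < s"
    and [measurable]: "g \<in> borel_measurable M" and H: "H \<subseteq> F" and R: "\<And>Q. Q \<in> H \<Longrightarrow> Q \<subseteq> R" "R \<in> sets M"
  shows "(\<integral>\<^sup>+x. (\<Sum>Q\<in>H. c Q * (\<integral>\<^sup>+y. g y * indicator Q y \<partial>M) * indicator Q x) \<partial>N) \<le>
     epowr (\<integral>\<^sup>+x. epowr (g x) s * indicator R x \<partial>M) (1 / s) *
     epowr (\<integral>\<^sup>+x. epowr (\<Sum>Q\<in>H. c Q * emeasure N Q * indicator Q x) (s / (s - 1)) \<partial>M) (1 / (s / (s - 1)))"
proof -
  note R(2)[measurable]
  have HM: "Q \<in> sets M" "Q \<in> sets N" if "Q \<in> H" for Q using H that N by auto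
  have [measurable]: "(\<lambda>x. \<Sum>Q\<in>H. c Q * emeasure N Q * indicator Q x) \<in> borel_measurable M"
    by (intro borel_measurable_sum borel_measurable_times_ennreal borel_measurable_indicator) (auto simp: HM)
  have im: "(\<lambda>x. k * indicator Q x) \<in> borel_measurable N" if "Q \<in> H" for Q and k :: ennreal
    by (intro borel_measurable_times_ennreal borel_measurable_indicator) (auto simp: HM that)
  have gm: "(\<lambda>x. g x * indicator Q x) \<in> borel_measurable M" if "Q \<in> H" for Q
    by (intro borel_measurable_times_ennreal borel_measurable_indicator) (auto simp: HM that)
  have "(\<integral>\<^sup>+x. (\<Sum>Q\<in>H. c Q * (\<integral>\<^sup>+y. g y * indicator Q y \<partial>M) * indicator Q x) \<partial>N)
      = (\<Sum>Q\<in>H. c Q * (\<integral>\<^sup>+y. g y * indicator Q y \<partial>M) * emeasure N Q)"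
    by (subst nn_integral_sum) (auto simp: HM nn_integral_cmult_indicator intro!: sum.cong im)
  also have "\<dots> = (\<Sum>Q\<in>H. \<integral>\<^sup>+y. c Q * emeasure N Q * (g y * indicator Q y) \<partial>M)"
    by (intro sum.cong refl, subst nn_integral_cmult) (auto simp: gm mult_ac)
  also have "\<dots> = (\<integral>\<^sup>+y. (\<Sum>Q\<in>H. c Q * emeasure N Q * (g y * indicator Q y)) \<partial>M)"
    by (intro nn_integral_sum[symmetric] borel_measurable_times_ennreal gm) auto
  also have "\<dots> = (\<integral>\<^sup>+y. (g y * indicator R y) * (\<Sum>Q\<in>H. c Q * emeasure N Q * indicator Q y) \<partial>M)"
    unfolding sum_distrib_left using R(1)
    by (intro nn_integral_cong sum.cong refl) (auto simp: indicator_def mult_ac)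
  also have "\<dots> \<le> epowr (\<integral>\<^sup>+x. epowr (g x * indicator R x) s \<partial>M) (1 / s) *
     epowr (\<integral>\<^sup>+x. epowr (\<Sum>Q\<in>H. c Q * emeasure N Q * indicator Q x) (s / (s - 1)) \<partial>M) (1 / (s / (s - 1)))"
  proof (rule Hoelder_inequality_nn)
    show "1 < s / (s - 1)" "1 / s + 1 / (s / (s - 1)) = 1" using s by (simp_all add: field_simps)
  qed (use s in measurable)
  finally show ?thesis using s by (simp add: epowr_mult)
qed

text \<open>A good-lambda argument: \<open>step\<close> compares the superlevel sets at heights 2 t
  and t, and \<open>good_lambda_absorb\<close> closes the estimate. The constant depends on r
  alone.\<close>

lemma weak_from_testing:
  assumes N: "laminar_family N F" "sets N = sets M" and s: "1 < s" "s \<le> r"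
    and c: "\<And>Q. Q \<in> F \<Longrightarrow> c Q < top" and T: "T < top"
    and testing: "\<And>R. R \<in> F \<Longrightarrow>
      epowr (\<integral>\<^sup>+x. epowr (\<Sum>Q\<in>{Q \<in> F. Q \<subseteq> R}. c Q * emeasure N Q * indicator Q x) (s / (s - 1)) \<partial>M) (1 / (s / (s - 1)))
        \<le> T * epowr (emeasure N R) (1 - 1 / r)"
    and [measurable]: "g \<in> borel_measurable M" and G: "(\<integral>\<^sup>+x. epowr (g x) s \<partial>M) < top"
    and t: "0 < t"
  shows "ennreal t * epowr (emeasure N {x \<in> space N. ennreal t <
             (\<Sum>Q\<in>F. c Q * (\<integral>\<^sup>+y. g y * indicator Q y \<partial>M) * indicator Q x)}) (1 / r)
    \<le> ennreal (2 powr ((r + 1)\<^sup>2 / r)) * (T * epowr (\<integral>\<^sup>+x. epowr (g x) s \<partial>M) (1 / s))"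
proof -
  interpret N: laminar_family N F by fact
  have r: "1 < r" "0 < r" using s by auto
  define a where "a Q = c Q * (\<integral>\<^sup>+y. g y * indicator Q y \<partial>M)" for Q
  define u where "u x = (\<Sum>Q\<in>F. a Q * indicator Q x)" for x
  define \<Omega> where "\<Omega> t = {x \<in> space N. ennreal t < u x}" for t
  define m where "m = emeasure N (\<Union>F)"
  obtain \<tau> where \<tau>: "T = ennreal \<tau>" "0 \<le> \<tau>" using T by (cases T) auto
  obtain E where E: "(\<integral>\<^sup>+x. epowr (g x) s \<partial>M) = ennreal E" "0 \<le> E"
    using G by (cases "\<integral>\<^sup>+x. epowr (g x) s \<partial>M") auto
  have [measurable]: "u \<in> borel_measurable N"
    unfolding u_def by (intro borel_measurable_sum borel_measurable_times_ennreal borel_measurable_indicator) auto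
  have [measurable]: "\<Omega> t \<in> sets N" for t unfolding \<Omega>_def by measurable
  have UF [measurable]: "\<Union>F \<in> sets N" by auto
  \<comment> \<open>Finite coefficients make \<open>u\<close> bounded, which yields the height
    \<open>B\<close> below.\<close>
  have a: "a Q < top" if "Q \<in> F" for Q
  proof -
    have "(\<integral>\<^sup>+y. g y * indicator Q y \<partial>M) < top"
      unfolding avg_mult[OF that, symmetric]
      using avg_less_top[OF s(1) _ G that] fin_F[OF that] by (simp add: ennreal_mult_less_top)
    then show ?thesis using c[OF that] by (simp add: a_def ennreal_mult_less_top)
  qed
  have m: "m < top"
  proof -
    have "m \<le> (\<Sum>Q\<in>F. emeasure N Q)" unfolding m_def
      using emeasure_subadditive_finite[of F "\<lambda>Q. Q" N] by (auto simp: subset_eq)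
    also have "\<dots> < top" by (subst ennreal_sum_less_top) (auto intro: N.fin_F)
    finally show ?thesis .
  qed
  have \<Omega>m: "emeasure N (\<Omega> t) \<le> m" for t
    unfolding m_def \<Omega>_def u_def superlevel_laminar_sum by (intro emeasure_mono UF) blast
  then have \<Omega>fin: "emeasure N (\<Omega> t) = ennreal (measure N (\<Omega> t))" for t
    using m by (intro emeasure_eq_ennreal_measure) (auto simp: less_top dest: order.strict_trans1)
  \<comment> \<open>The proportion that \<open>good_lambda_absorb\<close> can absorb.\<close>
  define d :: real where "d = 2 powr (- r - 1)"
  have d: "0 < d" unfolding d_def by (rule powr_gt_zero[THEN iffD2]) simp
  have step: "emeasure N (\<Omega> (2 * t)) \<le> ennreal d * emeasure N (\<Omega> t) +
      ennreal ((\<tau> / d) powr r * t powr (- r)) * epowr (ennreal E) (r / s)" if t: "0 < t" for t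
  proof -
    define H where "H = maximal_sets {Q \<in> F. ennreal t < (\<Sum>P\<in>{P \<in> F. Q \<subseteq> P}. a P)}"
    have HF: "H \<subseteq> F" unfolding H_def maximal_sets_def by blast
    then have Hfin: "finite H" by (rule finite_subset) simp
    have HS: "H \<subseteq> sets N" "H \<subseteq> sets M" using HF by auto
    have Hd: "disjoint H" unfolding H_def by (intro disjoint_maximal_sets laminar_subset[OF laminar_F]) auto
    have sp: "Q \<subseteq> space N" if "Q \<in> F" for Q using sets.sets_into_space[OF N.sets_F[OF that]] .
    have \<Omega>H: "\<Omega> t = \<Union>H"
      using sp unfolding \<Omega>_def H_def u_def superlevel_laminar_sum
      by (subst Union_maximal_sets) (simp, blast)
    have sub: "\<Omega> (2 * t) \<subseteq> \<Omega> t"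
    proof
      fix x assume "x \<in> \<Omega> (2 * t)"
      moreover have "ennreal t \<le> ennreal (2 * t)" using t by (intro ennreal_leI) auto
      ultimately show "x \<in> \<Omega> t" unfolding \<Omega>_def by auto
    qed
    \<comment> \<open>By \<open>localize_laminar_sum\<close>, \<open>?v\<close> exceeds t on the
      part of \<open>R\<close> surviving at height 2 t, so Chebyshev's inequality applies.
      \<open>testing_pairing\<close> and the testing condition bound the integral of
      \<open>?v\<close>, and \<open>good_lambda_alternative\<close> finishes.\<close>
    have local: "emeasure N (R \<inter> \<Omega> (2 * t)) \<le> ennreal d * emeasure N R +
       ennreal ((\<tau> / d) powr r * t powr (- r)) * epowr (\<integral>\<^sup>+x. epowr (g x) s * indicator R x \<partial>M) (r / s)"
      if RH: "R \<in> H" for R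
    proof -
      have RF: "R \<in> F" using RH HF by auto
      have [measurable]: "R \<in> sets N" "R \<in> sets M" using RF by auto
      let ?v = "\<lambda>x. \<Sum>Q\<in>{Q \<in> F. Q \<subseteq> R}. a Q * indicator Q x"
      have "ennreal t * emeasure N (R \<inter> \<Omega> (2 * t)) = (\<integral>\<^sup>+x. ennreal t * indicator (R \<inter> \<Omega> (2 * t)) x \<partial>N)"
        by (simp add: nn_integral_cmult_indicator)
      also have "\<dots> \<le> (\<integral>\<^sup>+x. ?v x \<partial>N)"
      proof (intro nn_integral_mono)
        fix x
        have "ennreal t < ?v x" if "x \<in> R" "x \<in> \<Omega> (2 * t)"
          using that RH t unfolding H_def \<Omega>_def u_def by (intro localize_laminar_sum) auto
        then show "ennreal t * indicator (R \<inter> \<Omega> (2 * t)) x \<le> ?v x"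
          by (auto simp: indicator_def[of "R \<inter> \<Omega> (2 * t)"])
      qed
      also have "\<dots> \<le> epowr (\<integral>\<^sup>+x. epowr (g x) s * indicator R x \<partial>M) (1 / s) *
         epowr (\<integral>\<^sup>+x. epowr (\<Sum>Q\<in>{Q \<in> F. Q \<subseteq> R}. c Q * emeasure N Q * indicator Q x) (s / (s - 1)) \<partial>M) (1 / (s / (s - 1)))"
        unfolding a_def by (intro testing_pairing N s) auto
      also have "\<dots> \<le> epowr (\<integral>\<^sup>+x. epowr (g x) s * indicator R x \<partial>M) (1 / s) * (T * epowr (emeasure N R) (1 - 1 / r))"
        by (intro mult_left_mono testing RF) auto
      finally have main: "ennreal t * emeasure N (R \<inter> \<Omega> (2 * t)) \<le> \<dots>" .
      have "(\<integral>\<^sup>+x. epowr (g x) s * indicator R x \<partial>M) \<le> ennreal E"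
        unfolding E(1)[symmetric] by (intro nn_integral_mono) (auto simp: indicator_def)
      then obtain e where e: "(\<integral>\<^sup>+x. epowr (g x) s * indicator R x \<partial>M) = ennreal e" "0 \<le> e"
        by (cases "\<integral>\<^sup>+x. epowr (g x) s * indicator R x \<partial>M") (auto simp: top_unique)
      obtain \<mu> where \<mu>: "emeasure N R = ennreal \<mu>" "0 < \<mu>"
        using N.pos_F[OF RF] N.fin_F[OF RF] by (cases "emeasure N R") auto
      have "emeasure N (R \<inter> \<Omega> (2 * t)) \<le> ennreal \<mu>"
        unfolding \<mu>(1)[symmetric] by (intro emeasure_mono) auto
      then obtain n where n: "emeasure N (R \<inter> \<Omega> (2 * t)) = ennreal n" "0 \<le> n" "n \<le> \<mu>"
        using \<mu> by (cases "emeasure N (R \<inter> \<Omega> (2 * t))") (auto simp: top_unique)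
      have r1: "0 < 1 - 1 / r" using r by simp
      have "t * n \<le> e powr (1 / s) * (\<tau> * \<mu> powr (1 - 1 / r))"
        using main e \<mu> n \<tau> t s r r1 by (simp add: epowr_ennreal flip: ennreal_mult)
      then have "n \<le> d * \<mu> + (\<tau> / d) powr r * t powr (- r) * e powr (r / s)"
        using n \<mu> d t e \<tau> s r by (intro good_lambda_alternative) auto
      then show ?thesis
        unfolding n(1) \<mu>(1) e(1) using s r e \<mu> d \<tau>
        by (simp add: epowr_ennreal flip: ennreal_mult ennreal_plus)
    qed
    have "emeasure N (\<Omega> (2 * t)) = (\<integral>\<^sup>+x. indicator (\<Omega> (2 * t)) x * indicator (\<Union>H) x \<partial>N)"
    proof -
      have "indicator (\<Omega> (2 * t)) x * indicator (\<Union>H) x = (indicator (\<Omega> (2 * t)) x :: ennreal)" for x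
        using sub unfolding \<Omega>H by (auto simp: indicator_def)
      then show ?thesis by simp
    qed
    also have "\<dots> = (\<Sum>R\<in>H. \<integral>\<^sup>+x. indicator (\<Omega> (2 * t)) x * indicator R x \<partial>N)"
      by (intro nn_integral_Union_disjoint Hfin Hd HS) auto
    also have "\<dots> = (\<Sum>R\<in>H. emeasure N (R \<inter> \<Omega> (2 * t)))"
    proof (intro sum.cong refl)
      fix R assume "R \<in> H"
      then have "R \<in> sets N" using HS by auto
      then have "emeasure N (R \<inter> \<Omega> (2 * t)) = (\<integral>\<^sup>+x. indicator (R \<inter> \<Omega> (2 * t)) x \<partial>N)" by simp
      also have "\<dots> = (\<integral>\<^sup>+x. indicator (\<Omega> (2 * t)) x * indicator R x \<partial>N)"
        by (intro nn_integral_cong) (auto simp: indicator_def)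
      finally show "(\<integral>\<^sup>+x. indicator (\<Omega> (2 * t)) x * indicator R x \<partial>N) = emeasure N (R \<inter> \<Omega> (2 * t))" by simp
    qed
    also have "\<dots> \<le> (\<Sum>R\<in>H. ennreal d * emeasure N R + ennreal ((\<tau> / d) powr r * t powr (- r)) *
        epowr (\<integral>\<^sup>+x. epowr (g x) s * indicator R x \<partial>M) (r / s))"
      by (intro sum_mono local)
    also have "\<dots> = ennreal d * (\<Sum>R\<in>H. emeasure N R) + ennreal ((\<tau> / d) powr r * t powr (- r)) *
        (\<Sum>R\<in>H. epowr (\<integral>\<^sup>+x. epowr (g x) s * indicator R x \<partial>M) (r / s))"
      by (simp add: sum.distrib sum_distrib_left)
    also have "(\<Sum>R\<in>H. emeasure N R) = emeasure N (\<Omega> t)"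
    proof -
      have "(\<Sum>R\<in>H. emeasure N R) = (\<Sum>R\<in>H. \<integral>\<^sup>+x. 1 * indicator R x \<partial>N)"
        using HS by (intro sum.cong) auto
      also have "\<dots> = (\<integral>\<^sup>+x. 1 * indicator (\<Union>H) x \<partial>N)"
        by (intro nn_integral_Union_disjoint[symmetric] Hfin Hd HS) auto
      also have "\<dots> = emeasure N (\<Omega> t)" by (simp flip: \<Omega>H)
      finally show ?thesis .
    qed
    \<comment> \<open>As r / s is at least 1, the powers of the local integrals add up to at most
      the power of the integral over the disjoint union.\<close>
    also have "(\<Sum>R\<in>H. epowr (\<integral>\<^sup>+x. epowr (g x) s * indicator R x \<partial>M) (r / s)) \<le> epowr (ennreal E) (r / s)"
    proof -
      have "(\<Sum>R\<in>H. epowr (\<integral>\<^sup>+x. epowr (g x) s * indicator R x \<partial>M) (r / s))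
         \<le> epowr (\<Sum>R\<in>H. \<integral>\<^sup>+x. epowr (g x) s * indicator R x \<partial>M) (r / s)"
        using s by (intro sum_epowr_le Hfin) auto
      also have "(\<Sum>R\<in>H. \<integral>\<^sup>+x. epowr (g x) s * indicator R x \<partial>M) = (\<integral>\<^sup>+x. epowr (g x) s * indicator (\<Union>H) x \<partial>M)"
        by (intro nn_integral_Union_disjoint[symmetric] Hfin Hd HS) auto
      also have "epowr \<dots> (r / s) \<le> epowr (ennreal E) (r / s)"
        using s unfolding E(1)[symmetric] by (intro epowr_mono nn_integral_mono) (auto simp: indicator_def)
      finally show ?thesis .
    qed
    finally show ?thesis by (simp add: add_left_mono mult_left_mono)
  qed
  define Z where "Z = (\<tau> / d) powr r * E powr (r / s)"
  have real_step: "measure N (\<Omega> (2 * t)) \<le> 2 powr (- r - 1) * measure N (\<Omega> t) + Z * t powr (- r)"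
    if t: "0 < t" for t
  proof -
    have "measure N (\<Omega> (2 * t)) \<le> d * measure N (\<Omega> t) + (\<tau> / d) powr r * t powr (- r) * E powr (r / s)"
      using step[OF t] E s r d \<tau> unfolding \<Omega>fin
      by (simp add: epowr_ennreal flip: ennreal_mult ennreal_plus)
    then show ?thesis by (simp add: Z_def d_def mult_ac)
  qed
  \<comment> \<open>\<open>u\<close> is bounded by the sum b of all coefficients, so superlevel sets
    are empty from height b + 1 on. Only the existence of such a height matters.\<close>
  obtain B where B: "0 < B" "\<And>t. B \<le> t \<Longrightarrow> measure N (\<Omega> t) = 0"
  proof -
    have "(\<Sum>Q\<in>F. a Q) < top" using a by (subst ennreal_sum_less_top) auto
    then obtain b where b: "(\<Sum>Q\<in>F. a Q) = ennreal b" "0 \<le> b" by (cases "\<Sum>Q\<in>F. a Q") auto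
    have "u x \<le> ennreal b" for x
      unfolding u_def b(1)[symmetric] by (intro sum_mono) (auto simp: indicator_def)
    then have "\<not> ennreal t < u x" if "b + 1 \<le> t" for t x
    proof -
      have "u x \<le> ennreal b" by fact
      also have "\<dots> \<le> ennreal t" using that by (intro ennreal_leI) auto
      finally show ?thesis by simp
    qed
    then have "\<Omega> t = {}" if "b + 1 \<le> t" for t
      using that by (auto simp: \<Omega>_def)
    then show thesis using b that[of "b + 1"] by auto
  qed
  have "measure N (\<Omega> t) \<le> enn2real m" for t
    using \<Omega>m[of t] m unfolding measure_def by (intro enn2real_mono) auto
  then have "t powr r * measure N (\<Omega> t) \<le> 2 powr (r + 1) * Z"
    using r B real_step t by (intro good_lambda_absorb[where B = B]) (auto simp: Z_def)
  then have "(t powr r * measure N (\<Omega> t)) powr (1 / r) \<le> (2 powr (r + 1) * Z) powr (1 / r)"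
    using r by (intro powr_mono2) auto
  also have "(t powr r * measure N (\<Omega> t)) powr (1 / r) = t * measure N (\<Omega> t) powr (1 / r)"
    using r t by (simp add: powr_mult powr_powr)
  \<comment> \<open>After the r-th root, absorption contributes (r + 1) / r to the exponent of 2 and
    1 / d contributes r + 1; together they give (r + 1)^2 / r.\<close>
  also have "(2 powr (r + 1) * Z) powr (1 / r) = 2 powr ((r + 1)\<^sup>2 / r) * (\<tau> * E powr (1 / s))"
  proof -
    have "(2 powr (r + 1) * Z) powr (1 / r) = 2 powr ((r + 1) / r) * (\<tau> / d) * E powr (1 / s)"
      using r E \<tau> d by (simp add: Z_def powr_mult powr_powr)
    also have "\<tau> / d = \<tau> * 2 powr (r + 1)"
      by (simp add: d_def powr_diff powr_minus_divide powr_add field_simps)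
    also have "2 powr ((r + 1) / r) * (\<tau> * 2 powr (r + 1)) = 2 powr ((r + 1) / r + (r + 1)) * \<tau>"
      by (simp add: powr_add)
    also have "(r + 1) / r + (r + 1) = (r + 1)\<^sup>2 / r"
      using r by (simp add: field_simps power2_eq_square)
    finally show ?thesis by simp
  qed
  finally have "ennreal (t * measure N (\<Omega> t) powr (1 / r)) \<le> ennreal (2 powr ((r + 1)\<^sup>2 / r) * (\<tau> * E powr (1 / s)))"
    by (rule ennreal_leI)
  moreover have "\<Omega> t = {x \<in> space N. ennreal t < (\<Sum>Q\<in>F. c Q * (\<integral>\<^sup>+y. g y * indicator Q y \<partial>M) * indicator Q x)}"
    by (simp add: \<Omega>_def u_def a_def)
  ultimately show ?thesis
    unfolding E(1) \<tau>(1) using r s E \<tau> t \<Omega>fin[of t] by (simp add: epowr_ennreal ennreal_mult)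
qed

end

section \<open>Cubes and weights\<close>

text \<open>Initial segments of an enumeration. One exhaustion serves all f at once: later the
  summands depend on a point x, and monotone convergence needs the same \<open>E n\<close> for every
  x.\<close>

lemma countable_exhaustion:
  assumes "countable A"
  shows "\<exists>E :: nat \<Rightarrow> 'a set. incseq E \<and> (\<forall>n. finite (E n) \<and> E n \<subseteq> A) \<and>
           (\<forall>f :: 'a \<Rightarrow> ennreal. infsum f A = (SUP n. sum f (E n)))"
proof -
  define E where "E n = {a \<in> A. to_nat_on A a < n}" for n
  have inj: "inj_on (to_nat_on A) A" using assms by (rule inj_on_to_nat_on)
  have fin: "finite (E n)" for n
  proof (rule finite_imageD)
    show "finite (to_nat_on A ` E n)" by (rule finite_subset[of _ "{..<n}"]) (auto simp: E_def)
    show "inj_on (to_nat_on A) (E n)" by (rule inj_on_subset[OF inj]) (auto simp: E_def)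
  qed
  have sub: "E n \<subseteq> A" for n by (auto simp: E_def)
  have inc: "incseq E" by (auto simp: incseq_def E_def)
  have "infsum f A = (SUP n. sum f (E n))" for f :: "'a \<Rightarrow> ennreal"
  proof -
    have "infsum f A = (SUP G\<in>{G. finite G \<and> G \<subseteq> A}. sum f G)"
      by (rule nonneg_infsum_complete) simp
    also have "\<dots> = (SUP n. sum f (E n))"
    proof (rule antisym)
      show "(SUP G\<in>{G. finite G \<and> G \<subseteq> A}. sum f G) \<le> (SUP n. sum f (E n))"
      proof (rule SUP_least)
        fix G assume "G \<in> {G. finite G \<and> G \<subseteq> A}"
        then have G: "finite G" "G \<subseteq> A" by auto
        have "finite (to_nat_on A ` G)" using G by simp
        then obtain n where "\<forall>k\<in>to_nat_on A ` G. k < n" using finite_nat_set_iff_bounded by blast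
        then have "G \<subseteq> E n" using G by (auto simp: E_def)
        then have "sum f G \<le> sum f (E n)" by (intro sum_mono2 fin) auto
        also have "\<dots> \<le> (SUP n. sum f (E n))" by (rule SUP_upper) simp
        finally show "sum f G \<le> (SUP n. sum f (E n))" .
      qed
      show "(SUP n. sum f (E n)) \<le> (SUP G\<in>{G. finite G \<and> G \<subseteq> A}. sum f G)"
        using fin sub by (intro SUP_least SUP_upper) auto
    qed
    finally show ?thesis .
  qed
  then show ?thesis using inc fin sub by blast
qed

lemma sum_le_infsum_ennreal:
  fixes f :: "'a \<Rightarrow> ennreal"
  assumes "finite G" "G \<subseteq> A" shows "sum f G \<le> infsum f A"
proof -
  have "sum f G \<le> (SUP G\<in>{G. finite G \<and> G \<subseteq> A}. sum f G)"
    using assms by (intro SUP_upper) simp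
  then show ?thesis by (simp add: nonneg_infsum_complete)
qed

section \<open>Cubes and dyadic grids\<close>

definition is_cube :: "(real^'n) set \<Rightarrow> bool" where
  "is_cube Q \<longleftrightarrow> (\<exists>a l. 0 < l \<and> Q = half_open_cube a l)"

lemma is_cube_powi: "is_cube (half_open_cube a (2 powi k))"
  unfolding is_cube_def by (intro exI[of _ a] exI[of _ "2 powi k"]) simp

lemma interior_cube:
  assumes "is_cube Q" shows "interior Q \<noteq> {}"
proof -
  obtain a l where Q: "0 < l" "Q = half_open_cube a l" using assms by (auto simp: is_cube_def)
  have "box a (\<chi> i. a $ i + l) \<subseteq> Q"
    by (auto simp: Q half_open_cube_def mem_box_cart less_imp_le)
  then have "box a (\<chi> i. a $ i + l) \<subseteq> interior Q" by (intro interior_maximal open_box)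
  moreover have "(\<chi> i. a $ i + l / 2) \<in> box a (\<chi> i. a $ i + l)"
    using Q by (simp add: mem_box_cart)
  ultimately show ?thesis by blast
qed

lemma cube_subset_cbox: "is_cube Q \<Longrightarrow> \<exists>a b. Q \<subseteq> cbox a b"
proof -
  assume "is_cube Q"
  then obtain a l where Q: "Q = half_open_cube a l" by (auto simp: is_cube_def)
  have "Q \<subseteq> cbox a (\<chi> i. a $ i + l)"
    by (auto simp: Q half_open_cube_def mem_box_cart less_imp_le)
  then show ?thesis by blast
qed

lemma sets_cube [measurable]: "is_cube Q \<Longrightarrow> Q \<in> sets lebesgue"
proof -
  assume "is_cube Q"
  then obtain a l where Q: "Q = half_open_cube a l" by (auto simp: is_cube_def)
  have "Q \<in> sets borel" unfolding Q half_open_cube_def by measurable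
  then show ?thesis by simp
qed

lemma measure_cube_pos:
  assumes "is_cube Q" shows "0 < measure lebesgue Q"
proof -
  obtain a b where "Q \<subseteq> cbox a b" using cube_subset_cbox[OF assms] by blast
  then have "Q \<in> lmeasurable"
    using assms by (intro bounded_set_imp_lmeasurable sets_cube) (auto intro: bounded_subset[OF bounded_cbox])
  moreover have "\<not> negligible Q"
    using open_not_negligible[OF open_interior interior_cube[OF assms]] negligible_subset[OF _ interior_subset]
    by metis
  ultimately have "measure lebesgue Q \<noteq> 0" by (simp add: negligible_iff_measure0)
  then show ?thesis by (simp add: zero_less_measure_iff)
qed

text \<open>The cubes of one generation are disjoint with nonempty interior, hence countably many,
  and generations are indexed by integers.\<close>

lemma countable_dyadic_grid:
  fixes D :: "(real^'n) set set"
  assumes "dyadic_grid D" shows "countable D"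
proof -
  have "countable (dyadic_generation D k)" for k
  proof (rule countable_disjoint_nonempty_interior_subsets)
    show "pairwise disjnt (dyadic_generation D k)"
      using assms by (auto simp: dyadic_grid_def partition_on_def)
    have "is_cube Q" if "Q \<in> dyadic_generation D k" for Q
      using that by (auto simp: dyadic_generation_def is_cube_powi)
    then show "S = {}" if "S \<in> dyadic_generation D k" "interior S = {}" for S
      using that interior_cube by blast
  qed
  then have "countable (\<Union>k. dyadic_generation D k)" by auto
  then show ?thesis using assms unfolding dyadic_grid_def by metis
qed

lemma is_cube_dyadic_grid:
  assumes "dyadic_grid D" "Q \<in> D" shows "is_cube Q"
proof -
  have "Q \<in> (\<Union>k. dyadic_generation D k)" using assms unfolding dyadic_grid_def by metis
  then show ?thesis by (auto simp: dyadic_generation_def is_cube_powi)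
qed

lemma laminar_dyadic_grid: "dyadic_grid D \<Longrightarrow> laminar D"
  by (simp add: dyadic_grid_def laminar_def)

text \<open>Local integrability makes the truncations of w to balls measurable; w is their pointwise
  limit.\<close>

lemma borel_measurable_weight:
  fixes w :: "real^'n \<Rightarrow> real"
  assumes "weight w" shows "w \<in> borel_measurable lebesgue"
proof (rule borel_measurable_LIMSEQ_real)
  show "(\<lambda>n. indicator (cball 0 (real n)) x *\<^sub>R w x) \<longlonglongrightarrow> w x" for x
  proof (rule tendsto_eventually)
    obtain n0 :: nat where "norm x \<le> n0" using real_arch_simple by blast
    then show "\<forall>\<^sub>F n in sequentially. indicator (cball 0 (real n)) x *\<^sub>R w x = w x"
      by (intro eventually_sequentiallyI[of n0]) (auto simp: indicator_def)
  qed
  show "(\<lambda>x. indicator (cball 0 (real n)) x *\<^sub>R w x) \<in> borel_measurable lebesgue" for n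
    using assms unfolding weight_def set_integrable_def
    by (intro borel_measurable_integrable) simp
qed

lemma space_weighted [simp]: "space (weighted w) = UNIV"
  by (simp add: weighted_def)

lemma sets_weighted [simp, measurable_cong]: "sets (weighted w) = sets lebesgue"
  by (simp add: weighted_def)

lemma emeasure_weighted:
  "weight w \<Longrightarrow> A \<in> sets lebesgue \<Longrightarrow> emeasure (weighted w) A = (\<integral>\<^sup>+x\<in>A. ennreal (w x) \<partial>lebesgue)"
  unfolding weighted_def using borel_measurable_weight[of w] by (intro emeasure_density) auto

lemma emeasure_weighted_compact:
  fixes w :: "real^'n \<Rightarrow> real"
  assumes w: "weight w" and K: "compact K" shows "emeasure (weighted w) K < top"
proof -
  have Kl: "K \<in> sets lebesgue" using K by (simp add: compact_imp_closed)
  have "integrable lebesgue (\<lambda>x. indicator K x *\<^sub>R w x)"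
    using w K by (simp add: weight_def set_integrable_def)
  then have "(\<integral>\<^sup>+x. ennreal (indicator K x *\<^sub>R w x) \<partial>lebesgue) < \<infinity>"
    using w by (subst (asm) integrable_iff_bounded) (auto simp: weight_def less_imp_le abs_mult)
  also have "(\<integral>\<^sup>+x. ennreal (indicator K x *\<^sub>R w x) \<partial>lebesgue) = (\<integral>\<^sup>+x\<in>K. ennreal (w x) \<partial>lebesgue)"
    by (intro nn_integral_cong) (auto simp: indicator_def)
  finally show ?thesis using w Kl by (simp add: emeasure_weighted)
qed

text \<open>A cube lies in a compact box, where w is integrable. Its Lebesgue measure is positive
  and w > 0 everywhere, so its weighted mass cannot vanish.\<close>

lemma emeasure_weighted_cube:
  assumes w: "weight w" and Q: "is_cube Q"
  shows "0 < emeasure (weighted w) Q" "emeasure (weighted w) Q < top"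
proof -
  obtain a b where "Q \<subseteq> cbox a b" using cube_subset_cbox[OF Q] by blast
  then have "emeasure (weighted w) Q \<le> emeasure (weighted w) (cbox a b)"
    by (intro emeasure_mono) auto
  also have "\<dots> < top" by (intro emeasure_weighted_compact w compact_cbox)
  finally show "emeasure (weighted w) Q < top" .
  have [measurable]: "w \<in> borel_measurable lebesgue" "Q \<in> sets lebesgue"
    using borel_measurable_weight[OF w] sets_cube[OF Q] by auto
  have "emeasure (weighted w) Q \<noteq> 0"
  proof
    assume "emeasure (weighted w) Q = 0"
    then have "(\<integral>\<^sup>+x\<in>Q. ennreal (w x) \<partial>lebesgue) = 0" using w by (simp add: emeasure_weighted)
    then have "AE x in lebesgue. x \<notin> Q"
      using w by (subst (asm) nn_integral_0_iff_AE)
        (auto simp: weight_def indicator_def ennreal_eq_0_iff not_le[symmetric] elim!: eventually_mono split: if_splits)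
    then have "emeasure lebesgue Q = 0" by (subst (asm) AE_iff_measurable[of Q]) auto
    then show False using measure_cube_pos[OF Q] by (simp add: measure_def)
  qed
  then show "0 < emeasure (weighted w) Q" by (simp add: zero_less_iff_neq_zero)
qed

lemma sigma_finite_weighted:
  fixes w :: "real^'n \<Rightarrow> real"
  assumes "weight w" shows "sigma_finite_measure (weighted w)"
proof
  have "\<Union>(range (\<lambda>n. cball (0 :: real^'n) (real n))) = UNIV"
    using real_arch_simple by auto
  then show "\<exists>A. countable A \<and> A \<subseteq> sets (weighted w) \<and> \<Union>A = space (weighted w) \<and>
      (\<forall>a\<in>A. emeasure (weighted w) a \<noteq> \<infinity>)"
    using emeasure_weighted_compact[OF assms compact_cball]
    by (intro exI[of _ "range (\<lambda>n. cball (0 :: real^'n) (real n))"]) (auto simp: less_top)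
qed

lemma laminar_family_weighted:
  assumes "weight w" "finite F" "laminar F" "\<And>Q. Q \<in> F \<Longrightarrow> is_cube Q"
  shows "laminar_family (weighted w) F"
  by (intro laminar_family.intro laminar_family_axioms.intro sigma_finite_weighted)
    (simp_all add: assms emeasure_weighted_cube sets_cube)

section \<open>The two-sided estimate\<close>

text \<open>Strictness of the inequality makes the level set of a supremum the union of the level
  sets, to which continuity from below applies.\<close>

lemma emeasure_SUP_level:
  fixes h :: "nat \<Rightarrow> 'a \<Rightarrow> ennreal"
  assumes "incseq h" and [measurable]: "\<And>n. h n \<in> borel_measurable N"
  shows "emeasure N {x \<in> space N. t < (SUP n. h n x)} = (SUP n. emeasure N {x \<in> space N. t < h n x})"
proof -
  have "(SUP n. emeasure N {x \<in> space N. t < h n x}) = emeasure N (\<Union>n. {x \<in> space N. t < h n x})"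
  proof (intro SUP_emeasure_incseq)
    show "incseq (\<lambda>n. {x \<in> space N. t < h n x})"
      using assms(1) by (auto simp: incseq_def le_fun_def dest: order.strict_trans2)
  qed auto
  also have "(\<Union>n. {x \<in> space N. t < h n x}) = {x \<in> space N. t < (SUP n. h n x)}"
    by (auto simp: less_SUP_iff)
  finally show ?thesis by simp
qed

section \<open>Sparse sums with a pair of weights\<close>

locale cube_family =
  fixes p q \<nu> \<alpha> :: real and S :: "(real^'n::finite) set set" and \<sigma> w :: "real^'n \<Rightarrow> real"
  assumes exponents: "1 < p" "p \<le> q" "0 < \<nu>" "\<nu> < p"
    and S: "countable S" "laminar S" "\<And>Q. Q \<in> S \<Longrightarrow> is_cube Q"
    and weights: "weight \<sigma>" "weight w"
begin

abbreviation "M \<equiv> weighted \<sigma>"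
abbreviation "N \<equiv> weighted w"

definition s where "s = p / \<nu>"
definition r where "r = q / \<nu>"
definition \<kappa> :: "(real^'n) set \<Rightarrow> real" where "\<kappa> Q = measure lebesgue Q powr (1 - \<alpha> / real CARD('n))"
text \<open>The coefficient of the linear operator: c Q times w(Q) is the factor in front of the
  indicator in the testing sum (\<open>c_emeasure_N\<close>), and c Q times \<sigma>(Q) is the
  \<nu>-th power of \<open>frac_avg \<alpha> Q \<sigma>\<close>.\<close>

definition c where "c Q = epowr (frac_avg \<alpha> Q \<sigma>) (\<nu> - 1) / ennreal (\<kappa> Q)"
text \<open>The \<nu>-th power of the sparse operator over \<open>G\<close>; height t of the
  operator is height t^\<nu> of \<open>Y\<close>.\<close>

definition Y where "Y G f x = (\<Sum>Q\<in>G. epowr (frac_avg \<alpha> Q (\<lambda>x. f x * \<sigma> x)) \<nu> * indicator Q x)"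

lemma s: "1 < s" and r: "1 < r" and sr: "s \<le> r"
  using exponents by (auto simp: s_def r_def divide_right_mono)

lemma conj_s: "conj_exp (p / \<nu>) = s / (s - 1)" and conj_r: "1 / conj_exp (q / \<nu>) = 1 - 1 / r"
  using exponents by (auto simp: s_def r_def conj_exp_def field_simps)

lemma conj_s_gt_1: "1 < s / (s - 1)"
  using s by simp

lemma kappa_pos: "Q \<in> S \<Longrightarrow> 0 < \<kappa> Q"
  using measure_cube_pos[OF S(3), of Q] by (simp add: \<kappa>_def)

lemma frac_avg_weight:
  assumes "weight v" "Q \<in> S"
  shows "frac_avg \<alpha> Q v = emeasure (weighted v) Q / ennreal (\<kappa> Q)"
  using assms S sets_cube by (simp add: frac_avg_def \<kappa>_def emeasure_weighted)

lemma laminar_family_M: "finite G \<Longrightarrow> G \<subseteq> S \<Longrightarrow> laminar_family M G"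
  and laminar_family_N: "finite G \<Longrightarrow> G \<subseteq> S \<Longrightarrow> laminar_family N G"
  using weights S by (auto intro!: laminar_family_weighted laminar_subset[of S])

lemma emeasure_MN:
  assumes "Q \<in> S"
  shows "0 < emeasure M Q" "emeasure M Q < top" "0 < emeasure N Q" "emeasure N Q < top"
  by (simp_all add: assms weights S emeasure_weighted_cube)

text \<open>Positivity matters as much as finiteness, because the exponent \<nu> - 1 may be zero or
  negative.\<close>

lemma frac_avg_sigma_real:
  assumes "Q \<in> S" obtains x where "0 < x" "frac_avg \<alpha> Q \<sigma> = ennreal x"
proof -
  obtain y where y: "emeasure M Q = ennreal y" "0 < y"
    using emeasure_MN[OF assms] by (cases "emeasure M Q") auto
  then show thesis using that[of "y / \<kappa> Q"] assms weights kappa_pos[OF assms]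
    by (simp add: frac_avg_weight divide_ennreal)
qed

lemma c_fin: "Q \<in> S \<Longrightarrow> c Q < top"
  by (rule frac_avg_sigma_real[of Q])
    (use kappa_pos[of Q] in \<open>auto simp: c_def epowr_real divide_ennreal\<close>)

lemma c_emeasure_N: "Q \<in> S \<Longrightarrow> c Q * emeasure N Q = epowr (frac_avg \<alpha> Q \<sigma>) (\<nu> - 1) * frac_avg \<alpha> Q w"
  using weights by (simp add: c_def frac_avg_weight ennreal_divide_times)

lemma sets_S [measurable]: "Q \<in> S \<Longrightarrow> Q \<in> sets lebesgue"
  using S sets_cube by auto

text \<open>Together with \<open>frac_avg_mult\<close> this puts linear and nonlinear summands in
  the same shape, with the common factor \<open>epowr (frac_avg \<alpha> Q \<sigma>) \<nu>\<close>.
  Comparing the operators then means comparing avg g with (avg f)^\<nu>.\<close>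

lemma c_integral:
  assumes G: "finite G" "G \<subseteq> S" and Q: "Q \<in> G"
  shows "c Q * (\<integral>\<^sup>+x. g x * indicator Q x \<partial>M) = epowr (frac_avg \<alpha> Q \<sigma>) \<nu> * laminar_family.avg M g Q"
proof -
  interpret laminar_family M G by (rule laminar_family_M[OF G])
  have QS: "Q \<in> S" using G Q by auto
  obtain x where x: "0 < x" "frac_avg \<alpha> Q \<sigma> = ennreal x" by (rule frac_avg_sigma_real[OF QS])
  have "c Q * (\<integral>\<^sup>+x. g x * indicator Q x \<partial>M) = c Q * (avg g Q * emeasure M Q)"
    using Q by (simp add: avg_mult)
  also have "\<dots> = epowr (frac_avg \<alpha> Q \<sigma>) (\<nu> - 1) * frac_avg \<alpha> Q \<sigma> * avg g Q"
    using weights QS by (simp add: c_def frac_avg_weight divide_ennreal_def mult_ac)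
  also have "epowr (frac_avg \<alpha> Q \<sigma>) (\<nu> - 1) * frac_avg \<alpha> Q \<sigma> = epowr (frac_avg \<alpha> Q \<sigma>) \<nu>"
    using x powr_add[of x "\<nu> - 1" 1] by (simp add: epowr_real flip: ennreal_mult)
  finally show ?thesis .
qed

lemma frac_avg_mult:
  assumes G: "finite G" "G \<subseteq> S" and Q: "Q \<in> G"
    and [measurable]: "f \<in> borel_measurable lebesgue" and nn: "\<And>x. 0 \<le> f x"
  shows "frac_avg \<alpha> Q (\<lambda>x. f x * \<sigma> x) = frac_avg \<alpha> Q \<sigma> * laminar_family.avg M (\<lambda>x. ennreal (f x)) Q"
proof -
  interpret laminar_family M G by (rule laminar_family_M[OF G])
  have QS: "Q \<in> S" using G Q by auto
  have [measurable]: "\<sigma> \<in> borel_measurable lebesgue" "Q \<in> sets lebesgue"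
    using weights borel_measurable_weight QS by auto
  have "(\<integral>\<^sup>+x\<in>Q. ennreal (f x * \<sigma> x) \<partial>lebesgue) = (\<integral>\<^sup>+x. ennreal (\<sigma> x) * (ennreal (f x) * indicator Q x) \<partial>lebesgue)"
    using nn weights by (intro nn_integral_cong) (simp add: ennreal_mult weight_def less_imp_le mult_ac)
  also have "\<dots> = (\<integral>\<^sup>+x. ennreal (f x) * indicator Q x \<partial>M)"
    unfolding weighted_def by (subst nn_integral_density) auto
  also have "\<dots> = avg (\<lambda>x. ennreal (f x)) Q * emeasure M Q"
    using Q by (simp add: avg_mult)
  finally have "frac_avg \<alpha> Q (\<lambda>x. f x * \<sigma> x) = avg (\<lambda>x. ennreal (f x)) Q * emeasure M Q / ennreal (\<kappa> Q)"
    by (simp only: frac_avg_def \<kappa>_def)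
  then show ?thesis
    using weights QS by (simp add: frac_avg_weight divide_ennreal_def mult_ac)
qed

lemma measurable_Y [measurable]:
  assumes "G \<subseteq> S" shows "Y G f \<in> borel_measurable lebesgue"
  unfolding Y_def[abs_def] using assms
  by (intro borel_measurable_sum borel_measurable_times_ennreal borel_measurable_indicator) auto

lemma less_sparse_op_iff:
  assumes "0 < t"
  shows "ennreal t < sparse_op \<alpha> \<nu> S (\<lambda>x. f x * \<sigma> x) x \<longleftrightarrow>
    ennreal (t powr \<nu>) < (\<Sum>\<^sub>\<infinity>Q\<in>S. epowr (frac_avg \<alpha> Q (\<lambda>x. f x * \<sigma> x)) \<nu> * indicator Q x)"
  using epowr_less_iff[of \<nu> "ennreal t" "sparse_op \<alpha> \<nu> S (\<lambda>x. f x * \<sigma> x) x"] exponents assms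
  by (simp add: sparse_op_def epowr_inverse epowr_real)

lemma Y_SUP:
  "\<exists>E :: nat \<Rightarrow> (real^'n) set set. incseq E \<and> (\<forall>n. finite (E n)) \<and> (\<forall>n. E n \<subseteq> S) \<and>
    (\<forall>f x. (\<Sum>\<^sub>\<infinity>Q\<in>S. epowr (frac_avg \<alpha> Q (\<lambda>x. f x * \<sigma> x)) \<nu> * indicator Q x) = (SUP n. Y (E n) f x)) \<and>
    (\<forall>f. incseq (\<lambda>n. Y (E n) f))"
proof -
  obtain E :: "nat \<Rightarrow> (real^'n) set set" where E: "incseq E" "\<And>n. finite (E n)" "\<And>n. E n \<subseteq> S"
    "\<And>f :: _ \<Rightarrow> ennreal. infsum f S = (SUP n. sum f (E n))"
    using countable_exhaustion[OF S(1)] by blast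
  have "incseq (\<lambda>n. Y (E n) f)" for f
    using E(1,2) unfolding incseq_def le_fun_def Y_def by (auto intro!: sum_mono2)
  then show ?thesis using E by (intro exI[of _ E]) (simp add: Y_def)
qed

section \<open>Sufficiency of testing\<close>

definition T where "T = dual_testing_const p q \<alpha> \<nu> S \<sigma> w"

text \<open>Finite subfamilies inherit the testing condition, and since 0 < w(R) < \<infinity> the
  negative power of w(R) can be moved across.\<close>

lemma testing_le:
  assumes R: "R \<in> S" and G: "finite G" "G \<subseteq> S"
  shows "epowr (\<integral>\<^sup>+x. epowr (\<Sum>Q\<in>{Q \<in> G. Q \<subseteq> R}. c Q * emeasure N Q * indicator Q x) (s / (s - 1)) \<partial>M) (1 / (s / (s - 1)))
      \<le> T * epowr (emeasure N R) (1 - 1 / r)"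
proof -
  obtain y where y: "emeasure N R = ennreal y" "0 < y"
    using emeasure_MN[OF R] by (cases "emeasure N R") auto
  define L where "L = Lp_norm (s / (s - 1)) M (\<lambda>x. \<Sum>\<^sub>\<infinity>Q\<in>{Q\<in>S. Q \<subseteq> R}.
                   epowr (frac_avg \<alpha> Q \<sigma>) (\<nu> - 1) * frac_avg \<alpha> Q w * indicator Q x)"
  have "(\<Sum>Q\<in>{Q \<in> G. Q \<subseteq> R}. c Q * emeasure N Q * indicator Q x) \<le>
     (\<Sum>\<^sub>\<infinity>Q\<in>{Q\<in>S. Q \<subseteq> R}. epowr (frac_avg \<alpha> Q \<sigma>) (\<nu> - 1) * frac_avg \<alpha> Q w * indicator Q x)" for x
  proof -
    have "(\<Sum>Q\<in>{Q \<in> G. Q \<subseteq> R}. c Q * emeasure N Q * indicator Q x) =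
      (\<Sum>Q\<in>{Q \<in> G. Q \<subseteq> R}. epowr (frac_avg \<alpha> Q \<sigma>) (\<nu> - 1) * frac_avg \<alpha> Q w * indicator Q x)"
    proof (rule sum.cong[OF refl])
      fix Q assume "Q \<in> {Q \<in> G. Q \<subseteq> R}"
      then have "Q \<in> S" using G by blast
      then show "c Q * emeasure N Q * indicator Q x = epowr (frac_avg \<alpha> Q \<sigma>) (\<nu> - 1) * frac_avg \<alpha> Q w * indicator Q x"
        by (simp only: c_emeasure_N)
    qed
    also have "\<dots> \<le> (\<Sum>\<^sub>\<infinity>Q\<in>{Q\<in>S. Q \<subseteq> R}. epowr (frac_avg \<alpha> Q \<sigma>) (\<nu> - 1) * frac_avg \<alpha> Q w * indicator Q x)"
      using G by (intro sum_le_infsum_ennreal) auto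
    finally show ?thesis .
  qed
  then have "epowr (\<integral>\<^sup>+x. epowr (\<Sum>Q\<in>{Q \<in> G. Q \<subseteq> R}. c Q * emeasure N Q * indicator Q x) (s / (s - 1)) \<partial>M) (1 / (s / (s - 1))) \<le> L"
    unfolding L_def Lp_norm_def using s conj_s_gt_1
    by (intro epowr_mono nn_integral_mono) auto
  also have "L \<le> T * epowr (emeasure N R) (1 - 1 / r)"
  proof -
    have "epowr (emeasure N R) (- (1 - 1 / r)) * L \<le> T"
      unfolding T_def dual_testing_const_def L_def conj_s[symmetric] conj_r[symmetric]
      by (rule SUP_upper2[OF R]) simp
    then have "epowr (emeasure N R) (1 - 1 / r) * (epowr (emeasure N R) (- (1 - 1 / r)) * L) \<le> epowr (emeasure N R) (1 - 1 / r) * T"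
      by (rule mult_left_mono) simp
    moreover have "epowr (emeasure N R) (1 - 1 / r) * epowr (emeasure N R) (- (1 - 1 / r)) = 1"
      unfolding y(1) epowr_real[OF y(2)] using y by (simp flip: ennreal_mult powr_add)
    ultimately show ?thesis by (simp add: mult.assoc[symmetric]) (simp add: mult.commute)
  qed
  finally show ?thesis .
qed

text \<open>Linearisation from above, with g the \<nu>-th power of the maximal function of f: avg f
  is below that function on all of Q, so (avg f)^\<nu> \<le> avg g for every \<nu> > 0. As \<nu> s =
  p, the L^s norm of g is controlled by the maximal theorem on L^p.\<close>

lemma upper_finite:
  assumes T: "T < top" and G: "finite G" "G \<subseteq> S"
    and f [measurable]: "f \<in> borel_measurable lebesgue" and nn: "\<And>x. 0 \<le> f x"
    and A: "(\<integral>\<^sup>+x. epowr (ennreal (f x)) p \<partial>M) < top" and t: "0 < t"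
  shows "ennreal t * epowr (emeasure N {x \<in> space N. ennreal t < Y G f x}) (1 / r) \<le>
    ennreal (2 powr ((r + 1)\<^sup>2 / r) * (p / (p - 1)) powr \<nu>) * T *
      epowr (\<integral>\<^sup>+x. epowr (ennreal (f x)) p \<partial>M) (1 / s)"
proof -
  interpret laminar_family M G by (rule laminar_family_M[OF G])
  let ?A = "\<integral>\<^sup>+x. epowr (ennreal (f x)) p \<partial>M"
  define g where "g x = epowr (mx (\<lambda>x. ennreal (f x)) x) \<nu>" for x
  have fM [measurable]: "(\<lambda>x. ennreal (f x)) \<in> borel_measurable M" by measurable
  have gM [measurable]: "g \<in> borel_measurable M" unfolding g_def by measurable
  have gs: "epowr (g x) s = epowr (mx (\<lambda>x. ennreal (f x)) x) p" for x
    using exponents by (simp add: g_def s_def epowr_epowr)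
  have gA: "(\<integral>\<^sup>+x. epowr (g x) s \<partial>M) \<le> ennreal ((p / (p - 1)) powr p) * ?A"
    unfolding gs by (rule mx_strong[OF exponents(1) fM])
  also have "\<dots> < top" using A by (simp add: ennreal_mult_less_top)
  finally have gfin: "(\<integral>\<^sup>+x. epowr (g x) s \<partial>M) < top" .
  let ?u = "\<lambda>x. \<Sum>Q\<in>G. c Q * (\<integral>\<^sup>+y. g y * indicator Q y \<partial>M) * indicator Q x"
  have u: "?u \<in> borel_measurable lebesgue"
    using G by (intro borel_measurable_sum borel_measurable_times_ennreal borel_measurable_indicator) auto
  have "Y G f x \<le> ?u x" for x
    unfolding Y_def
  proof (intro sum_mono mult_right_mono)
    fix Q assume Q: "Q \<in> G"
    have "epowr (frac_avg \<alpha> Q (\<lambda>x. f x * \<sigma> x)) \<nu> = epowr (frac_avg \<alpha> Q \<sigma>) \<nu> * epowr (avg (\<lambda>x. ennreal (f x)) Q) \<nu>"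
      using exponents by (simp add: frac_avg_mult[OF G Q f nn] epowr_mult)
    also have "\<dots> \<le> epowr (frac_avg \<alpha> Q \<sigma>) \<nu> * avg g Q"
      using exponents unfolding g_def
      by (intro mult_left_mono le_avg[OF Q] epowr_mono avg_le_mx[OF Q]) auto
    also have "\<dots> = c Q * (\<integral>\<^sup>+y. g y * indicator Q y \<partial>M)" by (simp add: c_integral[OF G Q])
    finally show "epowr (frac_avg \<alpha> Q (\<lambda>x. f x * \<sigma> x)) \<nu> \<le> c Q * (\<integral>\<^sup>+y. g y * indicator Q y \<partial>M)" .
  qed simp
  then have sub: "{x \<in> space N. ennreal t < Y G f x} \<subseteq> {x \<in> space N. ennreal t < ?u x}"
    by (auto simp del: sum_mult_indicator intro: order.strict_trans2)
  have "{x \<in> space lebesgue. ennreal t < ?u x} \<in> sets lebesgue"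
    using u by measurable
  then have meas: "{x \<in> space N. ennreal t < ?u x} \<in> sets N" by simp
  have "ennreal t * epowr (emeasure N {x \<in> space N. ennreal t < Y G f x}) (1 / r) \<le>
     ennreal t * epowr (emeasure N {x \<in> space N. ennreal t < ?u x}) (1 / r)"
    using r by (intro mult_left_mono epowr_mono emeasure_mono sub meas) auto
  also have "\<dots> \<le> ennreal (2 powr ((r + 1)\<^sup>2 / r)) * (T * epowr (\<integral>\<^sup>+x. epowr (g x) s \<partial>M) (1 / s))"
  proof (rule weak_from_testing)
    show "laminar_family N G" by (rule laminar_family_N[OF G])
    show "c Q < top" if "Q \<in> G" for Q using c_fin G that by auto
    show "epowr (\<integral>\<^sup>+x. epowr (\<Sum>Q\<in>{Q \<in> G. Q \<subseteq> R}. c Q * emeasure N Q * indicator Q x) (s / (s - 1)) \<partial>M) (1 / (s / (s - 1)))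
      \<le> T * epowr (emeasure N R) (1 - 1 / r)" if "R \<in> G" for R
      using that G by (intro testing_le) auto
  qed (use s sr T gfin t in auto)
  also have "\<dots> \<le> ennreal (2 powr ((r + 1)\<^sup>2 / r)) * (T * epowr (ennreal ((p / (p - 1)) powr p) * ?A) (1 / s))"
    using s by (intro mult_left_mono epowr_mono gA) auto
  also have "epowr (ennreal ((p / (p - 1)) powr p) * ?A) (1 / s) = ennreal ((p / (p - 1)) powr \<nu>) * epowr ?A (1 / s)"
    using s exponents by (simp add: epowr_mult epowr_ennreal powr_powr) (simp add: s_def)
  finally show ?thesis by (simp add: ennreal_mult mult_ac)
qed

lemma upper_bound:
  "epowr (weak_op_norm p q \<alpha> \<nu> S \<sigma> w) \<nu> \<le> ennreal (2 powr ((r + 1)\<^sup>2 / r) * (p / (p - 1)) powr \<nu>) * T"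
proof (cases "T = top")
  case True
  then show ?thesis using exponents by (simp add: ennreal_mult_top)
next
  case False
  then have T: "T < top" by (simp add: less_top)
  define K where "K = ennreal (2 powr ((r + 1)\<^sup>2 / r) * (p / (p - 1)) powr \<nu>)"
  \<comment> \<open>The operator norm is an infimum, so it suffices that this number is an
    admissible constant.\<close>
  have "weak_op_norm p q \<alpha> \<nu> S \<sigma> w \<le> epowr (K * T) (1 / \<nu>)"
    unfolding weak_op_norm_def
  proof (rule Inf_lower, rule CollectI, intro allI impI)
    fix f :: "real^'n \<Rightarrow> real"
    assume f: "f \<in> borel_measurable lebesgue" "\<forall>x. 0 \<le> f x"
      and fin: "Lp_norm p M (\<lambda>x. ennreal (f x)) < \<infinity>"
    let ?A = "\<integral>\<^sup>+x. epowr (ennreal (f x)) p \<partial>M"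
    have A: "?A < top" using fin exponents by (simp add: Lp_norm_def)
    obtain E :: "nat \<Rightarrow> (real^'n) set set" where E: "incseq E" "\<And>n. finite (E n)" "\<And>n. E n \<subseteq> S"
      "\<And>f x. (\<Sum>\<^sub>\<infinity>Q\<in>S. epowr (frac_avg \<alpha> Q (\<lambda>x. f x * \<sigma> x)) \<nu> * indicator Q x) = (SUP n. Y (E n) f x)"
      "\<And>f. incseq (\<lambda>n. Y (E n) f)"
      using Y_SUP by metis
    \<comment> \<open>The bound for finite families does not depend on the family and therefore
      survives the limit along the exhaustion.\<close>
    have lim: "ennreal t * epowr (emeasure N {x \<in> space N. ennreal t < (SUP n. Y (E n) f x)}) (1 / r) \<le> K * T * epowr ?A (1 / s)"
      if t: "0 < t" for t
    proof -
      have "ennreal t * epowr (emeasure N {x \<in> space N. ennreal t < (SUP n. Y (E n) f x)}) (1 / r) =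
         (SUP n. ennreal t * epowr (emeasure N {x \<in> space N. ennreal t < Y (E n) f x}) (1 / r))"
        using r E(3,5) by (subst emeasure_SUP_level) (auto simp: epowr_Sup SUP_mult_left_ennreal measurable_Y)
      also have "\<dots> \<le> K * T * epowr ?A (1 / s)"
        unfolding K_def using f t by (intro SUP_least upper_finite T E A) auto
      finally show ?thesis .
    qed
    show "weak_Lp_norm q N (sparse_op \<alpha> \<nu> S (\<lambda>x. f x * \<sigma> x)) \<le> epowr (K * T) (1 / \<nu>) * Lp_norm p M (\<lambda>x. ennreal (f x))"
      unfolding weak_Lp_norm_def
    proof (rule SUP_least)
      fix t :: real assume "t \<in> {0<..}"
      then have t: "0 < t" by simp
      \<comment> \<open>The estimate is used at height t^\<nu>; the root 1 / \<nu> then restores the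
        exponents, by r \<nu> = q and s \<nu> = p.\<close>
      let ?m = "emeasure N {x \<in> space N. ennreal (t powr \<nu>) < (SUP n. Y (E n) f x)}"
      have "epowr (ennreal (t powr \<nu>) * epowr ?m (1 / r)) (1 / \<nu>) \<le> epowr (K * T * epowr ?A (1 / s)) (1 / \<nu>)"
        using t exponents by (intro epowr_mono lim) auto
      also have "epowr (ennreal (t powr \<nu>) * epowr ?m (1 / r)) (1 / \<nu>) = ennreal t * epowr ?m (1 / q)"
        using t exponents r by (simp add: epowr_mult epowr_epowr epowr_ennreal powr_powr) (simp add: r_def)
      also have "epowr (K * T * epowr ?A (1 / s)) (1 / \<nu>) = epowr (K * T) (1 / \<nu>) * epowr ?A (1 / p)"
        using exponents s by (simp add: epowr_mult epowr_epowr) (simp add: s_def)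
      finally show "ennreal t * epowr (emeasure N {x \<in> space N. ennreal t < sparse_op \<alpha> \<nu> S (\<lambda>x. f x * \<sigma> x) x}) (1 / q)
          \<le> epowr (K * T) (1 / \<nu>) * Lp_norm p M (\<lambda>x. ennreal (f x))"
        by (simp only: less_sparse_op_iff[OF t] E(4) Lp_norm_def)
    qed
  qed
  then have "epowr (weak_op_norm p q \<alpha> \<nu> S \<sigma> w) \<nu> \<le> epowr (epowr (K * T) (1 / \<nu>)) \<nu>"
    using exponents by (intro epowr_mono) auto
  then show ?thesis using exponents by (simp add: epowr_inverse K_def)
qed

text \<open>Necessity on finite families by a dual extremiser. With s' = s / (s - 1), h the testing
  function and g = h^(s'-1), the integral X of h^s' equals that of h g, which is the w-integral over
  \<open>R\<close> of the linear operator applied to g. The weak bound and Kolmogorov's inequality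
  control it by a multiple of X^(1/s), and X is absorbed.\<close>

lemma lower_finite:
  assumes G: "finite G" "G \<subseteq> S" and R: "R \<in> S" "\<And>Q. Q \<in> G \<Longrightarrow> Q \<subseteq> R"
    and C: "C < top" and bound: "\<And>f. f \<in> borel_measurable lebesgue \<Longrightarrow> (\<forall>x. 0 \<le> f x) \<Longrightarrow>
        Lp_norm p M (\<lambda>x. ennreal (f x)) < \<infinity> \<Longrightarrow>
        weak_Lp_norm q N (sparse_op \<alpha> \<nu> S (\<lambda>x. f x * \<sigma> x)) \<le> C * Lp_norm p M (\<lambda>x. ennreal (f x))"
  shows "(\<integral>\<^sup>+x. epowr (\<Sum>Q\<in>G. c Q * emeasure N Q * indicator Q x) (s / (s - 1)) \<partial>M) \<le>
     epowr (ennreal (r / (r - 1) * (s / (s - 1))) * epowr C \<nu> * epowr (emeasure N R) (1 - 1 / r)) (s / (s - 1))"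
proof -
  interpret laminar_family M G by (rule laminar_family_M[OF G])
  define s' where "s' = s / (s - 1)"
  have s': "1 < s'" "1 - 1 / s' = 1 / s" "(s' - 1) * s = s'" "1 + (s' - 1) = s'"
    using s by (auto simp: s'_def field_simps)
  have GM: "Q \<in> sets M" "Q \<in> sets N" "Q \<in> sets lebesgue" if "Q \<in> G" for Q using G that by auto
  define h where "h x = (\<Sum>Q\<in>G. c Q * emeasure N Q * indicator Q x)" for x
  define X where "X = (\<integral>\<^sup>+x. epowr (h x) s' \<partial>M)"
  define g where "g x = epowr (h x) (s' - 1)" for x
  have hM [measurable]: "h \<in> borel_measurable M"
    unfolding h_def by (intro borel_measurable_sum borel_measurable_times_ennreal borel_measurable_indicator) (auto simp: GM)
  have gM [measurable]: "g \<in> borel_measurable M" unfolding g_def by measurable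
  \<comment> \<open>Absorption needs finiteness: h is at most \<open>H\<close> on the union of
    \<open>G\<close> and vanishes elsewhere.\<close>
  have X: "X < top"
  proof -
    define H where "H = (\<Sum>Q\<in>G. c Q * emeasure N Q)"
    have "H < top" unfolding H_def using G c_fin emeasure_MN
      by (subst ennreal_sum_less_top) (auto simp: ennreal_mult_less_top subset_eq)
    have "epowr (h x) s' \<le> epowr H s' * (\<Sum>Q\<in>G. indicator Q x)" for x
    proof (cases "x \<in> \<Union>G")
      case True
      then obtain Q where Q: "Q \<in> G" "x \<in> Q" by blast
      have "h x \<le> H" unfolding h_def H_def by (intro sum_mono) (auto simp: indicator_def)
      then have "epowr (h x) s' * 1 \<le> epowr H s' * (\<Sum>Q\<in>G. indicator Q x)"
      proof (intro mult_mono epowr_mono)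
        have "indicator Q x \<le> (\<Sum>Q\<in>G. indicator Q x :: ennreal)"
          using Q by (intro member_le_sum[of Q G "\<lambda>Q. indicator Q x"]) auto
        then show "1 \<le> (\<Sum>Q\<in>G. indicator Q x :: ennreal)" using Q by simp
      qed (use s' in auto)
      then show ?thesis by simp
    next
      case False
      then have "h x = 0" unfolding h_def by (intro sum.neutral) (auto simp: indicator_def)
      then show ?thesis using s' by simp
    qed
    then have "X \<le> (\<integral>\<^sup>+x. epowr H s' * (\<Sum>Q\<in>G. indicator Q x) \<partial>M)"
      unfolding X_def by (intro nn_integral_mono)
    also have "\<dots> = epowr H s' * (\<Sum>Q\<in>G. emeasure M Q)"
      by (subst nn_integral_cmult, use GM in measurable)
         (subst nn_integral_sum, auto simp: GM)
    also have "\<dots> < top"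
      using \<open>H < top\<close> s' fin_F by (auto simp: ennreal_mult_less_top)
    finally show ?thesis .
  qed
  have gs: "epowr (g x) s = epowr (h x) s'" for x
    using s s' by (simp add: g_def epowr_epowr)
  have gX: "(\<integral>\<^sup>+x. epowr (g x) s \<partial>M) = X" by (simp add: gs X_def)
  have mxfin: "mx g x < top" for x
    by (intro mx_less_top avg_less_top[OF s gM]) (simp_all add: gX X)
  \<comment> \<open>Linearisation from below: on Q the function f is at least (avg g)^(1/\<nu>),
    whence avg g \<le> (avg f)^\<nu>. The operator norm tests real-valued f, so finiteness of the
    maximal function enters here.\<close>
  define f where "f x = enn2real (epowr (mx g x) (1 / \<nu>))" for x
  have ef: "ennreal (f x) = epowr (mx g x) (1 / \<nu>)" for x
    using mxfin[of x] exponents by (simp add: f_def ennreal_enn2real)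
  have "f \<in> borel_measurable M" unfolding f_def by measurable
  then have f: "f \<in> borel_measurable lebesgue" "\<And>x. 0 \<le> f x" by (auto simp: f_def)
  have fp: "epowr (ennreal (f x)) p = epowr (mx g x) s" for x
    using exponents by (simp add: ef epowr_epowr s_def)
  have "(\<integral>\<^sup>+x. epowr (ennreal (f x)) p \<partial>M) \<le> ennreal (s' powr s) * X"
    using mx_strong[OF s gM] by (simp add: fp gX s'_def)
  then have "Lp_norm p M (\<lambda>x. ennreal (f x)) \<le> epowr (ennreal (s' powr s) * X) (1 / p)"
    unfolding Lp_norm_def using exponents by (intro epowr_mono) auto
  moreover have "\<dots> < top" using X exponents by (simp add: ennreal_mult_less_top)
  ultimately have Lpf: "Lp_norm p M (\<lambda>x. ennreal (f x)) < \<infinity>"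
    "Lp_norm p M (\<lambda>x. ennreal (f x)) \<le> epowr (ennreal (s' powr s) * X) (1 / p)" by auto
  define u where "u x = (\<Sum>Q\<in>G. c Q * (\<integral>\<^sup>+y. g y * indicator Q y \<partial>M) * indicator Q x)" for x
  have uN [measurable]: "u \<in> borel_measurable N"
    unfolding u_def by (intro borel_measurable_sum borel_measurable_times_ennreal borel_measurable_indicator) (auto simp: GM)
  obtain E :: "nat \<Rightarrow> (real^'n) set set" where E: "incseq E" "\<And>n. finite (E n)" "\<And>n. E n \<subseteq> S"
    "\<And>f x. (\<Sum>\<^sub>\<infinity>Q\<in>S. epowr (frac_avg \<alpha> Q (\<lambda>x. f x * \<sigma> x)) \<nu> * indicator Q x) = (SUP n. Y (E n) f x)"
    "\<And>f. incseq (\<lambda>n. Y (E n) f)"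
    using Y_SUP by metis
  have uY: "u x \<le> (SUP n. Y (E n) f x)" for x
  proof -
    have "u x \<le> Y G f x"
      unfolding u_def Y_def
    proof (intro sum_mono mult_right_mono)
      fix Q assume Q: "Q \<in> G"
      have "epowr (avg g Q) (1 / \<nu>) \<le> avg (\<lambda>x. ennreal (f x)) Q"
        using exponents by (intro le_avg[OF Q]) (auto simp: ef intro!: epowr_mono avg_le_mx[OF Q])
      then have "avg g Q \<le> epowr (avg (\<lambda>x. ennreal (f x)) Q) \<nu>"
        using exponents by (simp add: le_epowr_iff_epowr_le)
      then have "epowr (frac_avg \<alpha> Q \<sigma>) \<nu> * avg g Q \<le> epowr (frac_avg \<alpha> Q \<sigma>) \<nu> * epowr (avg (\<lambda>x. ennreal (f x)) Q) \<nu>"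
        by (rule mult_left_mono) simp
      then show "c Q * (\<integral>\<^sup>+y. g y * indicator Q y \<partial>M) \<le> epowr (frac_avg \<alpha> Q (\<lambda>x. f x * \<sigma> x)) \<nu>"
        using exponents by (simp add: frac_avg_mult[OF G Q f] epowr_mult c_integral[OF G Q])
    qed simp
    also have "\<dots> \<le> (\<Sum>\<^sub>\<infinity>Q\<in>S. epowr (frac_avg \<alpha> Q (\<lambda>x. f x * \<sigma> x)) \<nu> * indicator Q x)"
      unfolding Y_def by (intro sum_le_infsum_ennreal G)
    finally show ?thesis by (simp only: E(4))
  qed
  \<comment> \<open>The weak bound of \<open>u\<close>; its factor s' is the s-th root of the
    constant of \<open>mx_strong\<close> on L^s.\<close>
  define B where "B = epowr C \<nu> * (ennreal s' * epowr X (1 / s))"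
  have weak: "ennreal t * epowr (emeasure N {x \<in> space N. ennreal t < u x}) (1 / r) \<le> B" if t: "0 < t" for t
  proof -
    \<comment> \<open>\<open>u\<close> is dominated by the \<nu>-th power of the operator, so height
      t of \<open>u\<close> corresponds to height t^(1/\<nu>) of the operator.\<close>
    define \<theta> where "\<theta> = t powr (1 / \<nu>)"
    have \<theta>: "0 < \<theta>" "\<theta> powr \<nu> = t" using t exponents by (auto simp: \<theta>_def powr_powr)
    have [measurable]: "Y (E n) f \<in> borel_measurable N" for n using measurable_Y[OF E(3)] by simp
    let ?m = "emeasure N {x \<in> space N. ennreal t < (SUP n. Y (E n) f x)}"
    have "ennreal \<theta> * epowr ?m (1 / q) = ennreal \<theta> * epowr (emeasure N {x \<in> space N. ennreal \<theta> < sparse_op \<alpha> \<nu> S (\<lambda>x. f x * \<sigma> x) x}) (1 / q)"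
      by (simp only: less_sparse_op_iff[OF \<theta>(1)] E(4) \<theta>(2))
    also have "\<dots> \<le> weak_Lp_norm q N (sparse_op \<alpha> \<nu> S (\<lambda>x. f x * \<sigma> x))"
      unfolding weak_Lp_norm_def using \<theta> by (intro SUP_upper) auto
    also have "\<dots> \<le> C * Lp_norm p M (\<lambda>x. ennreal (f x))"
      using f Lpf by (intro bound) auto
    also have "\<dots> \<le> C * epowr (ennreal (s' powr s) * X) (1 / p)"
      by (intro mult_left_mono Lpf) simp
    finally have "epowr (ennreal \<theta> * epowr ?m (1 / q)) \<nu> \<le> epowr (C * epowr (ennreal (s' powr s) * X) (1 / p)) \<nu>"
      using exponents by (intro epowr_mono) auto
    moreover have "epowr (ennreal \<theta> * epowr ?m (1 / q)) \<nu> = ennreal t * epowr ?m (1 / r)"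
      using exponents \<theta> by (simp add: epowr_mult epowr_epowr epowr_ennreal r_def)
    moreover have "epowr (C * epowr (ennreal (s' powr s) * X) (1 / p)) \<nu> = B"
    proof -
      have "epowr (epowr (ennreal (s' powr s) * X) (1 / p)) \<nu> = epowr (ennreal (s' powr s) * X) (1 / s)"
        using exponents by (simp add: epowr_epowr s_def)
      also have "\<dots> = ennreal s' * epowr X (1 / s)"
        using s s' by (simp add: epowr_mult epowr_ennreal powr_powr)
      finally show ?thesis using exponents by (simp add: epowr_mult B_def)
    qed
    moreover have "ennreal t * epowr (emeasure N {x \<in> space N. ennreal t < u x}) (1 / r) \<le> ennreal t * epowr ?m (1 / r)"
    proof (intro mult_left_mono epowr_mono emeasure_mono)
      show "{x \<in> space N. ennreal t < u x} \<subseteq> {x \<in> space N. ennreal t < (SUP n. Y (E n) f x)}"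
        using uY by (blast intro: order.strict_trans2)
      show "{x \<in> space N. ennreal t < (SUP n. Y (E n) f x)} \<in> sets N" by measurable
    qed (use r in auto)
    ultimately show ?thesis by simp
  qed
  have "X = (\<integral>\<^sup>+x. (\<Sum>Q\<in>G. c Q * emeasure N Q * (g x * indicator Q x)) \<partial>M)"
  proof -
    have "epowr (h x) s' = (\<Sum>Q\<in>G. c Q * emeasure N Q * (g x * indicator Q x))" for x
    proof -
      have "epowr (h x) s' = h x * g x"
        using epowr_add[of 1 "s' - 1" "h x"] s' by (simp add: g_def)
      also have "\<dots> = (\<Sum>Q\<in>G. c Q * emeasure N Q * indicator Q x * g x)"
        unfolding h_def by (rule sum_distrib_right)
      also have "\<dots> = (\<Sum>Q\<in>G. c Q * emeasure N Q * (g x * indicator Q x))"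
        by (intro sum.cong refl) (simp only: mult_ac)
      finally show ?thesis .
    qed
    then show ?thesis by (simp add: X_def)
  qed
  also have "\<dots> = (\<Sum>Q\<in>G. c Q * (\<integral>\<^sup>+y. g y * indicator Q y \<partial>M) * emeasure N Q)"
  proof -
    have gi: "(\<lambda>x. g x * indicator Q x) \<in> borel_measurable M" if "Q \<in> G" for Q
      by (intro borel_measurable_times_ennreal borel_measurable_indicator gM GM that)
    have "(\<integral>\<^sup>+x. (\<Sum>Q\<in>G. c Q * emeasure N Q * (g x * indicator Q x)) \<partial>M)
        = (\<Sum>Q\<in>G. \<integral>\<^sup>+x. c Q * emeasure N Q * (g x * indicator Q x) \<partial>M)"
      by (intro nn_integral_sum borel_measurable_times_ennreal gi) auto
    also have "\<dots> = (\<Sum>Q\<in>G. c Q * emeasure N Q * (\<integral>\<^sup>+x. g x * indicator Q x \<partial>M))"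
      by (intro sum.cong refl nn_integral_cmult gi)
    finally show ?thesis by (simp only: mult_ac)
  qed
  also have "\<dots> = (\<integral>\<^sup>+x. u x \<partial>N)"
    unfolding u_def by (subst nn_integral_sum)
      (auto simp: GM nn_integral_cmult_indicator intro!: sum.cong borel_measurable_times_ennreal borel_measurable_indicator)
  also have "\<dots> = (\<integral>\<^sup>+x. u x * indicator R x \<partial>N)"
  proof (intro nn_integral_cong)
    fix x
    show "u x = u x * indicator R x"
    proof (cases "x \<in> R")
      case False
      then have "u x = 0" unfolding u_def using R by (intro sum.neutral) (auto simp: indicator_def)
      then show ?thesis by simp
    qed simp
  qed
  also have "\<dots> \<le> ennreal (r / (r - 1)) * B * epowr (emeasure N R) (1 - 1 / r)"
  proof (rule Kolmogorov_inequality[OF sigma_finite_weighted[OF weights(2)] r uN _ _ _ _ weak])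
    show "u x < top" for x
    proof -
      have "c Q * (\<integral>\<^sup>+y. g y * indicator Q y \<partial>M) < top" if Q: "Q \<in> G" for Q
      proof -
        have "avg g Q < top" by (rule avg_less_top[OF s gM _ Q]) (simp add: gX X)
        then show ?thesis using avg_mult[OF Q, of g] fin_F[OF Q] c_fin[of Q] Q G
          by (auto simp: ennreal_mult_less_top simp flip: avg_mult)
      qed
      then show ?thesis unfolding u_def
        by (subst ennreal_sum_less_top) (auto simp: indicator_def)
    qed
  qed (use R emeasure_MN in auto)
  \<comment> \<open>Since 1 / s = 1 - 1 / s', the power of X takes the form required by
    \<open>le_epowr_absorb\<close>.\<close>
  also have "\<dots> = (ennreal (r / (r - 1) * s') * epowr C \<nu> * epowr (emeasure N R) (1 - 1 / r)) * epowr X (1 - 1 / s')"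
  proof -
    have "ennreal (r / (r - 1) * s') = ennreal (r / (r - 1)) * ennreal s'"
      using r s' by (intro ennreal_mult) auto
    then show ?thesis by (simp only: B_def s'(2) mult_ac)
  qed
  finally have "X \<le> epowr (ennreal (r / (r - 1) * s') * epowr C \<nu> * epowr (emeasure N R) (1 - 1 / r)) s'"
    by (rule le_epowr_absorb[OF s'(1) X])
  then show ?thesis by (simp only: X_def h_def s'_def)
qed

text \<open>The constant \<open>K\<close> multiplies the norm constants r / (r - 1) of Kolmogorov's
  inequality and s / (s - 1) of the maximal theorem. Each finite admissible C gives T \<le> K
  C^\<nu>; the infimum over C follows.\<close>

lemma lower_bound:
  "ennreal (1 / (r / (r - 1) * (s / (s - 1)))) * T \<le> epowr (weak_op_norm p q \<alpha> \<nu> S \<sigma> w) \<nu>"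
proof -
  define K where "K = r / (r - 1) * (s / (s - 1))"
  have K: "0 < K" using r s by (simp add: K_def)
  have "epowr (ennreal (1 / K) * T) (1 / \<nu>) \<le> weak_op_norm p q \<alpha> \<nu> S \<sigma> w"
    unfolding weak_op_norm_def
  proof (rule Inf_greatest)
    fix C assume "C \<in> {C. \<forall>f. f \<in> borel_measurable lebesgue \<longrightarrow> (\<forall>x. 0 \<le> f x) \<longrightarrow>
               Lp_norm p M (\<lambda>x. ennreal (f x)) < \<infinity> \<longrightarrow>
               weak_Lp_norm q N (sparse_op \<alpha> \<nu> S (\<lambda>x. f x * \<sigma> x)) \<le> C * Lp_norm p M (\<lambda>x. ennreal (f x))}"
    then have C: "\<And>f. f \<in> borel_measurable lebesgue \<Longrightarrow> (\<forall>x. 0 \<le> f x) \<Longrightarrow>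
               Lp_norm p M (\<lambda>x. ennreal (f x)) < \<infinity> \<Longrightarrow>
               weak_Lp_norm q N (sparse_op \<alpha> \<nu> S (\<lambda>x. f x * \<sigma> x)) \<le> C * Lp_norm p M (\<lambda>x. ennreal (f x))"
      by blast
    show "epowr (ennreal (1 / K) * T) (1 / \<nu>) \<le> C"
    proof (cases "C = top")
      case False
      then have Cfin: "C < top" by (simp add: less_top)
      have "T \<le> ennreal K * epowr C \<nu>"
        unfolding T_def dual_testing_const_def conj_s conj_r
      proof (rule SUP_least)
        fix R assume R: "R \<in> S"
        obtain y where y: "emeasure N R = ennreal y" "0 < y"
          using emeasure_MN[OF R] by (cases "emeasure N R") auto
        define S' where "S' = {Q \<in> S. Q \<subseteq> R}"
        have S': "countable S'" "S' \<subseteq> S" using S(1) by (auto simp: S'_def)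
        obtain E :: "nat \<Rightarrow> (real^'n) set set" where E: "incseq E" "\<And>n. finite (E n)" "\<And>n. E n \<subseteq> S'"
          "\<And>f :: _ \<Rightarrow> ennreal. infsum f S' = (SUP n. sum f (E n))"
          using countable_exhaustion[OF S'(1)] by blast
        define h where "h n x = (\<Sum>Q\<in>E n. c Q * emeasure N Q * indicator Q x)" for n x
        have ES: "E n \<subseteq> S" for n using E(3) S' by blast
        have h: "(\<Sum>\<^sub>\<infinity>Q\<in>S'. epowr (frac_avg \<alpha> Q \<sigma>) (\<nu> - 1) * frac_avg \<alpha> Q w * indicator Q x) = (SUP n. h n x)" for x
          unfolding E(4) h_def
        proof (intro SUP_cong refl sum.cong)
          fix n Q assume "Q \<in> E n"
          then have "Q \<in> S" using ES by blast
          then show "epowr (frac_avg \<alpha> Q \<sigma>) (\<nu> - 1) * frac_avg \<alpha> Q w * indicator Q x = c Q * emeasure N Q * indicator Q x"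
            by (simp only: c_emeasure_N)
        qed
        have inc: "incseq h"
          using E(1,2) unfolding incseq_def le_fun_def h_def by (auto intro!: sum_mono2)
        have hM: "h n \<in> borel_measurable M" for n
          unfolding h_def using subsetD[OF ES] sets_S
          by (intro borel_measurable_sum borel_measurable_times_ennreal borel_measurable_indicator) auto
        define s' where "s' = s / (s - 1)"
        have s': "1 < s'" using s by (simp add: s'_def)
        \<comment> \<open>Monotone convergence carries \<open>lower_finite\<close> to the infinite
          testing sum, since its bound is the same for all finite families inside
          \<open>R\<close>.\<close>
        have "(\<integral>\<^sup>+x. epowr (SUP n. h n x) s' \<partial>M) = (\<integral>\<^sup>+x. (SUP n. epowr (h n x) s') \<partial>M)"
          using s' by (simp add: epowr_Sup)
        also have "\<dots> = (SUP n. \<integral>\<^sup>+x. epowr (h n x) s' \<partial>M)"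
        proof (rule nn_integral_monotone_convergence_SUP)
          show "incseq (\<lambda>n x. epowr (h n x) s')"
            using inc s' by (auto simp: incseq_def le_fun_def intro!: epowr_mono)
        qed (use hM in measurable)
        also have "\<dots> \<le> epowr (ennreal K * epowr C \<nu> * epowr (emeasure N R) (1 - 1 / r)) s'"
          unfolding h_def s'_def K_def
          using E(3) S' by (intro SUP_least lower_finite[OF E(2) ES R _ Cfin C]) (auto simp: S'_def)
        finally have "Lp_norm s' M (\<lambda>x. SUP n. h n x) \<le> ennreal K * epowr C \<nu> * epowr (emeasure N R) (1 - 1 / r)"
          unfolding Lp_norm_def using s' by (simp add: epowr_le_iff_le_epowr epowr_inverse)
        then have "epowr (emeasure N R) (- (1 - 1 / r)) * Lp_norm s' M (\<lambda>x. SUP n. h n x) \<le>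
            epowr (emeasure N R) (- (1 - 1 / r)) * (ennreal K * epowr C \<nu> * epowr (emeasure N R) (1 - 1 / r))"
          by (rule mult_left_mono) simp
        also have "\<dots> = ennreal K * epowr C \<nu> * (epowr (emeasure N R) (- (1 - 1 / r)) * epowr (emeasure N R) (1 - 1 / r))"
          by (simp only: mult_ac)
        also have "epowr (emeasure N R) (- (1 - 1 / r)) * epowr (emeasure N R) (1 - 1 / r) = 1"
          unfolding y(1) epowr_real[OF y(2)] using y by (simp flip: ennreal_mult powr_add)
        finally show "epowr (emeasure N R) (- (1 - 1 / r)) * Lp_norm (s / (s - 1)) M
            (\<lambda>x. \<Sum>\<^sub>\<infinity>Q\<in>{Q \<in> S. Q \<subseteq> R}. epowr (frac_avg \<alpha> Q \<sigma>) (\<nu> - 1) * frac_avg \<alpha> Q w * indicator Q x)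
              \<le> ennreal K * epowr C \<nu>"
          by (simp only: S'_def[symmetric] h s'_def mult_1_right)
      qed
      then have "ennreal (1 / K) * T \<le> ennreal (1 / K) * (ennreal K * epowr C \<nu>)"
        by (rule mult_left_mono) simp
      also have "\<dots> = epowr C \<nu>"
        using K by (simp add: mult.assoc[symmetric] flip: ennreal_mult)
      finally show ?thesis using exponents by (simp add: epowr_le_iff_le_epowr)
    qed simp
  qed
  then show ?thesis using exponents by (simp add: le_epowr_iff_epowr_le K_def)
qed

end

theorem theorem1p2:
  fixes p q \<nu> \<alpha> \<gamma> :: real
  assumes "1 < p" "p \<le> q" "0 < \<nu>" "\<nu> < p"
    and "0 \<le> \<alpha>" "\<alpha> < real CARD('n)"
    and "0 < \<gamma>" "\<gamma> < 1"
  shows "\<exists>c C :: real. 0 < c \<and> 0 < C \<and>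
    (\<forall>(D :: (real^'n::finite) set set) S \<sigma> w.
       dyadic_grid D \<longrightarrow> S \<subseteq> D \<longrightarrow> sparse_family \<gamma> S \<longrightarrow> weight \<sigma> \<longrightarrow> weight w \<longrightarrow>
       ennreal c * dual_testing_const p q \<alpha> \<nu> S \<sigma> w
           \<le> epowr (weak_op_norm p q \<alpha> \<nu> S \<sigma> w) \<nu> \<and>
       epowr (weak_op_norm p q \<alpha> \<nu> S \<sigma> w) \<nu>
           \<le> ennreal C * dual_testing_const p q \<alpha> \<nu> S \<sigma> w)"
proof -
  \<comment> \<open>The constants have to be named before grid, family and weights are chosen;
    \<open>a\<close> and \<open>b\<close> anticipate \<open>r\<close> and \<open>s\<close> of the
    locale.\<close>
  define a where "a = q / \<nu>"
  define b where "b = p / \<nu>"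
  have ab: "1 < a" "1 < b" using assms by (auto simp: a_def b_def)
  show ?thesis
  proof (intro exI conjI allI impI)
    show "0 < 1 / (a / (a - 1) * (b / (b - 1)))" "0 < 2 powr ((a + 1)\<^sup>2 / a) * (p / (p - 1)) powr \<nu>"
      using ab assms by auto
    fix D S :: "(real^'n) set set" and \<sigma> w :: "real^'n \<Rightarrow> real"
    assume D: "dyadic_grid D" "S \<subseteq> D" and W: "weight \<sigma>" "weight w"
    interpret cube_family p q \<nu> \<alpha> S \<sigma> w
    proof
      show "countable S" using countable_dyadic_grid[OF D(1)] D(2) by (rule countable_subset[rotated])
      show "laminar S" using laminar_dyadic_grid[OF D(1)] D(2) by (rule laminar_subset)
      show "is_cube Q" if "Q \<in> S" for Q using is_cube_dyadic_grid[OF D(1)] D(2) that by blast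
    qed (use assms W in auto)
    show "ennreal (1 / (a / (a - 1) * (b / (b - 1)))) * dual_testing_const p q \<alpha> \<nu> S \<sigma> w
           \<le> epowr (weak_op_norm p q \<alpha> \<nu> S \<sigma> w) \<nu>"
      using lower_bound by (simp only: a_def b_def r_def s_def T_def)
    show "epowr (weak_op_norm p q \<alpha> \<nu> S \<sigma> w) \<nu>
           \<le> ennreal (2 powr ((a + 1)\<^sup>2 / a) * (p / (p - 1)) powr \<nu>) * dual_testing_const p q \<alpha> \<nu> S \<sigma> w"
      using upper_bound by (simp only: a_def b_def r_def s_def T_def)
  qed
qed

end
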